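(* A CW algebra $\mathfrak g_b=\mathfrak h+\mathfrak m=E^*+(E+\mathbb R\mathrm p+\mathbb R\mathrm q)$ with $\dim E=8$ admits non-zero charge spin representations if and only if $B=\pm\mathrm{Id}$. In this case a non-zero charge spin representation is given by $$\rho(e^\flat)=\sqrt2\begin{pmatrix}0&Be\\0&0\end{pmatrix},\qquad\rho(e)=\sqrt2\begin{pmatrix}-e\circ\pi^-&0\\0&e\circ\pi^+\end{pmatrix}\qquad(e\in E),$$ $$\rho(\mathrm p)=4\begin{pmatrix}0&\pi^+\\0&0\end{pmatrix},\qquad\rho(\mathrm q)=\begin{pmatrix}0&\pm\mathrm{Id}\\-\pi^-&0\end{pmatrix},$$ where the sign in $\rho(\mathrm q)$ is that of $B=\pm\mathrm{Id}$.
   Context: $E=\mathbb R^{0,8}$ is an $8$-dimensional real vector space with a negative definite inner product $\langle\cdot,\cdot\rangle$; $e^\flat=\langle e,\cdot\rangle\in E^*$. $b$ is a non-degenerate symmetric bilinear form on $E$ and $B\in\mathrm{End}_{\mathbb R}(E)$ is defined by $b(\cdot,\cdot)=-\langle B\cdot,\cdot\rangle$. Standing normalization (not restrictive up to isomorphism of CW algebras): the eigenvalues $b_1\le\dots\le b_8$ of $B$ (non-zero reals) satisfy $\sum_i b_i^2=\dim E=8$. $\mathfrak m=E+\mathbb R\mathrm p+\mathbb R\mathrm q$ is Minkowski space ($\mathrm p,\mathrm q$ isotropic, orthogonal to $E$, $\langle\mathrm p,\mathrm q\rangle=1$). The Cahen-Wallach (CW) algebra associated with $b$ is the Lie algebra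 $\mathfrak g_b=\mathfrak h+\mathfrak m=E^*+(E+\mathbb R\mathrm p+\mathbb R\mathrm q)$ whose only non-trivial brackets are $[\mathrm q,e]=e^\flat$, $[e^\flat,f]=b(e,f)\mathrm p$, $[e^\flat,\mathrm q]=B(e)$ ($e,f\in E$). $\mathrm{Cl}_{0,8}$ is the Clifford algebra of $E$ with convention $v^2=-\langle v,v\rangle$, $S_{0,8}$ the real irreducible $\mathrm{Cl}_{0,8}$-module, on which vectors of $E$ act by Clifford multiplication. The volume form acts on $S_{0,8}$ as an involution with $\pm1$-eigenspaces $S_{0,8}^\pm$ (semi-spinors); $\pi^\pm$ is the projection of $S_{0,8}$ onto $S_{0,8}^\pm$. $S=S_{1,9}$ is the real irreducible $\mathrm{Cl}(\mathfrak m)$-module, identified as a vector space with $S=S_-+S_+=S_{0,8}+S_{0,8}$ (endomorphisms written as $2\times2$ block matrices) in such a way that $\mathrm p\wedge e\in\mathfrak{so}(\mathfrak m)$ acts as $\begin{pmatrix}0&\sqrt2\,e\\0&0\end{pmatrix}$. A representation $\rho:\mathfrak g_b\to\mathfrak{gl}_{\mathbb R}(S)$ is spin if $\rho(e^\flat)=\begin{pmatrix}0&\sqrt2\,Be\\0&0\end{pmatrix}$ for all $e\in E$ (the spin action of $\mathrm p\wedge Be$). It has non-zero charge if $\rho(\mathrm p)\neq0$. *)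

theory Defs
  imports "HOL-Analysis.Analysis"
begin

section \<open>The negative definite space and its dual\<close>

text \<open>The carrier type \<open>'e\<close> of class \<open>euclidean_space\<close> plays the role of \<open>E = R^{0,8}\<close> (the
  statement assumes \<open>DIM('e) = 8\<close>). The positive definite product \<open>\<bullet>\<close> of the class is the
  \<^emph>\<open>negative\<close> of the inner product of \<open>E\<close>.\<close>

definition einner :: "'e::euclidean_space \<Rightarrow> 'e \<Rightarrow> real" where
  "einner x y = - (x \<bullet> y)"

definition flat :: "'e::euclidean_space \<Rightarrow> ('e \<Rightarrow>\<^sub>L real)" where
  "flat e = Blinfun (\<lambda>x. einner e x)"

definition sharp :: "('e::euclidean_space \<Rightarrow>\<^sub>L real) \<Rightarrow> 'e" where
  "sharp = inv flat"

lemma flat_apply: "blinfun_apply (flat e) x = einner e x"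
proof -
  have "bounded_linear (\<lambda>x. einner e x)"
    unfolding einner_def by (intro bounded_linear_minus bounded_linear_inner_right)
  then show ?thesis by (simp add: flat_def bounded_linear_Blinfun_apply)
qed

lemma linear_flat: "linear flat"
  by (rule linearI) (auto intro!: blinfun_eqI
      simp: flat_apply einner_def inner_add_left blinfun.add_left blinfun.scaleR_left)

lemma flat_eq_iff: "flat x = flat y \<longleftrightarrow> x = y"
proof
  assume "flat x = flat y"
  then have "einner x z = einner y z" for z by (metis flat_apply)
  then have "(x - y) \<bullet> z = 0" for z by (simp add: einner_def inner_diff_left)
  then show "x = y" using inner_eq_zero_iff[of "x - y"] by simp
qed simp

lemma flat_surj: "\<exists>e. flat e = \<phi>"
proof
  show "flat (- (\<Sum>i\<in>Basis. blinfun_apply \<phi> i *\<^sub>R i)) = \<phi>"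
    by (rule blinfun_euclidean_eqI) (simp add: flat_apply einner_def inner_sum_left inner_Basis if_distrib
      cong: if_cong)
qed

lemma flat_sharp [simp]: "flat (sharp \<phi>) = \<phi>"
  unfolding sharp_def using flat_surj by (metis surj_def surj_f_inv_f)

lemma sharp_flat [simp]: "sharp (flat e) = e"
  using flat_eq_iff flat_sharp by blast

lemma linear_sharp: "linear sharp"
  by (rule linearI; rule iffD1[OF flat_eq_iff])
     (simp_all add: linear_add[OF linear_flat] linear_scale[OF linear_flat])


section \<open>Cahen-Wallach algebras\<close>

definition nondegenerate_form :: "('e::real_vector \<Rightarrow> 'e \<Rightarrow> real) \<Rightarrow> bool" where
  "nondegenerate_form b \<longleftrightarrow> (\<forall>x. (\<forall>y. b x y = 0) \<longrightarrow> x = 0)"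

definition symmetric_form :: "('e \<Rightarrow> 'e \<Rightarrow> real) \<Rightarrow> bool" where
  "symmetric_form b \<longleftrightarrow> (\<forall>x y. b x y = b y x)"

definition cw_endo :: "('e::euclidean_space \<Rightarrow> 'e \<Rightarrow> real) \<Rightarrow> 'e \<Rightarrow> 'e" where
  "cw_endo b = (THE B. \<forall>x y. b x y = - einner (B x) y)"

lemma cw_endo_unique:
  assumes "\<And>x y. b x y = - einner (B x) y"
  shows "cw_endo b = B"
  unfolding cw_endo_def
proof (rule the_equality)
  fix C assume C: "\<forall>x y. b x y = - einner (C x) y"
  show "C = B"
  proof
    fix x
    have "(C x - B x) \<bullet> y = 0" for y
      using C assms[of x y] by (simp add: einner_def inner_diff_left)
    then show "C x = B x" using inner_eq_zero_iff[of "C x - B x"] by simp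
  qed
qed (use assms in blast)

lemma cw_endo:
  assumes "bilinear b"
  shows "b x y = - einner (cw_endo b x) y"
proof -
  define B where "B = (\<lambda>x. \<Sum>i\<in>Basis. b x i *\<^sub>R i)"
  have *: "b x y = - einner (B x) y" for x y
  proof -
    have l: "linear (b x)" using assms by (simp add: bilinear_def)
    have "b x y = b x (\<Sum>i\<in>Basis. (y \<bullet> i) *\<^sub>R i)" by (simp add: euclidean_representation)
    also have "\<dots> = (\<Sum>i\<in>Basis. (y \<bullet> i) * b x i)"
      by (simp add: linear_sum[OF l] linear_scale[OF l])
    also have "\<dots> = B x \<bullet> y"
      by (simp add: B_def inner_sum_left inner_commute[of y] mult.commute)
    finally show ?thesis by (simp add: einner_def)
  qed
  then have "cw_endo b = B" by (rule cw_endo_unique)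
  then show ?thesis using * by simp
qed

lemma linear_cw_endo:
  assumes "bilinear b"
  shows "linear (cw_endo b)"
proof -
  have ip: "cw_endo b x \<bullet> y = b x y" for x y using cw_endo[OF assms, of x y] by (simp add: einner_def)
  show ?thesis
    by (rule linearI; rule vector_eq_rdot[THEN iffD1])
       (auto simp: ip inner_add_left bilinear_ladd[OF assms] bilinear_lmul[OF assms])
qed

text \<open>\<open>eigenvalue_sequence A \<beta>\<close>: the numbers \<open>\<beta> 1 \<le> \<dots> \<le> \<beta> n\<close> with \<open>n = DIM('e)\<close> are the
  eigenvalues of \<open>A\<close>, each repeated according to its multiplicity. For the diagonalizable
  endomorphisms considered here the multiplicity is the dimension of the eigenspace (which is \<open>0\<close>
  if \<open>l\<close> is not an eigenvalue).\<close>

definition eigenvalue_sequence :: "('e::euclidean_space \<Rightarrow> 'e) \<Rightarrow> (nat \<Rightarrow> real) \<Rightarrow> bool" where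
  "eigenvalue_sequence A \<beta> \<longleftrightarrow>
     mono_on {1..DIM('e)} \<beta> \<and>
     (\<forall>l. card {i \<in> {1..DIM('e)}. \<beta> i = l} = dim {v. A v = l *\<^sub>R v})"

text \<open>Minkowski space \<open>m = E + R p + R q\<close>; the triple \<open>(e, s, t)\<close> stands for \<open>e + s p + t q\<close>.\<close>

type_synonym 'e minkowski = "'e \<times> real \<times> real"

definition minner :: "'e::euclidean_space minkowski \<Rightarrow> 'e minkowski \<Rightarrow> real" where
  "minner = (\<lambda>(e, s, t) (e', s', t'). einner e e' + s * t' + t * s')"

definition vec_E :: "'e::euclidean_space \<Rightarrow> 'e minkowski" where "vec_E e = (e, 0, 0)"
definition vec_p :: "'e::euclidean_space minkowski" where "vec_p = (0, 1, 0)"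
definition vec_q :: "'e::euclidean_space minkowski" where "vec_q = (0, 0, 1)"

text \<open>The underlying space of the CW algebra is \<open>h + m\<close> with \<open>h = E^*\<close>.\<close>

type_synonym 'e cw = "('e \<Rightarrow>\<^sub>L real) \<times> 'e minkowski"

definition in_h :: "('e::euclidean_space \<Rightarrow>\<^sub>L real) \<Rightarrow> 'e cw" where "in_h \<phi> = (\<phi>, 0)"
definition in_m :: "'e::euclidean_space minkowski \<Rightarrow> 'e cw" where "in_m w = (0, w)"

definition cw_bracket :: "('e::euclidean_space \<Rightarrow> 'e \<Rightarrow> real) \<Rightarrow> 'e cw \<Rightarrow> 'e cw \<Rightarrow> 'e cw" where
  "cw_bracket b = (\<lambda>(\<phi>, e, s, t) (\<phi>', e', s', t').
     (t *\<^sub>R flat e' - t' *\<^sub>R flat e,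
      t' *\<^sub>R cw_endo b (sharp \<phi>) - t *\<^sub>R cw_endo b (sharp \<phi>'),
      b (sharp \<phi>) e' - b (sharp \<phi>') e,
      0))"

text \<open>Since \<open>flat\<close> is onto, the following determine the bracket by bilinearity.\<close>

lemma cw_bracket_generators:
  assumes "bilinear b"
  shows "cw_bracket b (in_m vec_q) (in_m (vec_E e)) = in_h (flat e)"
    and "cw_bracket b (in_h (flat e)) (in_m (vec_E f)) = in_m (b e f *\<^sub>R vec_p)"
    and "cw_bracket b (in_h (flat e)) (in_m vec_q) = in_m (vec_E (cw_endo b e))"
    and "cw_bracket b (in_h (flat e)) (in_h (flat f)) = 0"
    and "cw_bracket b (in_m (vec_E e)) (in_m (vec_E f)) = 0"
    and "cw_bracket b (in_m vec_p) X = 0"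
  by (auto simp: linear_0[OF linear_flat] linear_0[OF linear_sharp] linear_0[OF linear_cw_endo[OF assms]]
      bilinear_lzero[OF assms] bilinear_rzero[OF assms] cw_bracket_def in_h_def in_m_def vec_q_def vec_E_def vec_p_def zero_prod_def
      split: prod.splits)

definition lie_bracket :: "('g::real_vector \<Rightarrow> 'g \<Rightarrow> 'g) \<Rightarrow> bool" where
  "lie_bracket br \<longleftrightarrow> bilinear br \<and> (\<forall>x. br x x = 0) \<and>
     (\<forall>x y z. br x (br y z) + br y (br z x) + br z (br x y) = 0)"

lemma lie_bracket_cw:
  assumes b: "bilinear b" and "symmetric_form b"
  shows "lie_bracket (cw_bracket b)"
proof -
  have sym: "b x y = b y x" for x y using assms(2) by (simp add: symmetric_form_def)
  have BB: "b x (cw_endo b y) = b y (cw_endo b x)" for x y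
    using cw_endo[OF b, of x "cw_endo b y"] cw_endo[OF b, of y "cw_endo b x"]
    by (simp add: einner_def inner_commute)
  note lin = linear_add[OF linear_flat] linear_scale[OF linear_flat] linear_0[OF linear_flat]
    linear_diff[OF linear_flat] linear_diff[OF linear_sharp] linear_diff[OF linear_cw_endo[OF b]]
    linear_add[OF linear_sharp] linear_scale[OF linear_sharp] linear_0[OF linear_sharp]
    linear_add[OF linear_cw_endo[OF b]] linear_scale[OF linear_cw_endo[OF b]]
    linear_0[OF linear_cw_endo[OF b]]
    bilinear_ladd[OF b] bilinear_radd[OF b] bilinear_lmul[OF b] bilinear_rmul[OF b]
    bilinear_lzero[OF b] bilinear_rzero[OF b] bilinear_lsub[OF b] bilinear_rsub[OF b]
  have "bilinear (cw_bracket b)"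
    unfolding bilinear_def
    by (intro allI conjI; rule linearI)
       (auto simp: cw_bracket_def lin algebra_simps split: prod.splits)
  moreover have "cw_bracket b x x = 0" for x
    by (auto simp: cw_bracket_def zero_prod_def split: prod.splits)
  moreover have "cw_bracket b x (cw_bracket b y z) + cw_bracket b y (cw_bracket b z x)
      + cw_bracket b z (cw_bracket b x y) = 0" for x y z
  proof -
    obtain \<phi>1 e1 s1 t1 where x: "x = (\<phi>1, e1, s1, t1)" by (metis prod_cases4)
    obtain \<phi>2 e2 s2 t2 where y: "y = (\<phi>2, e2, s2, t2)" by (metis prod_cases4)
    obtain \<phi>3 e3 s3 t3 where z: "z = (\<phi>3, e3, s3, t3)" by (metis prod_cases4)
    have BBs: "b (sharp \<phi>2) (cw_endo b (sharp \<phi>1)) = b (sharp \<phi>1) (cw_endo b (sharp \<phi>2))"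
      "b (sharp \<phi>3) (cw_endo b (sharp \<phi>1)) = b (sharp \<phi>1) (cw_endo b (sharp \<phi>3))"
      "b (sharp \<phi>3) (cw_endo b (sharp \<phi>2)) = b (sharp \<phi>2) (cw_endo b (sharp \<phi>3))"
      "b e2 e1 = b e1 e2" "b e3 e1 = b e1 e3" "b e3 e2 = b e2 e3"
      by (simp_all add: BB sym)
    show ?thesis
      unfolding x y z
      by (simp add: cw_bracket_def zero_prod_def lin BBs algebra_simps)
  qed
  ultimately show ?thesis by (simp add: lie_bracket_def)
qed

text \<open>\<open>gl(V)\<close> is the space \<open>'v \<Rightarrow>\<^sub>L 'v\<close> of (automatically bounded) endomorphisms of the
  finite-dimensional space \<open>'v\<close>; the Euclidean structure of \<open>'v\<close> plays no role.\<close>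

definition lie_representation ::
    "('g::real_vector \<Rightarrow> 'g \<Rightarrow> 'g) \<Rightarrow> ('g \<Rightarrow> ('v::euclidean_space \<Rightarrow>\<^sub>L 'v)) \<Rightarrow> bool" where
  "lie_representation br \<rho> \<longleftrightarrow>
     linear \<rho> \<and> (\<forall>x y. \<rho> (br x y) = (\<rho> x o\<^sub>L \<rho> y) - (\<rho> y o\<^sub>L \<rho> x))"


section \<open>Clifford modules and spinors\<close>

text \<open>By the universal property of the Clifford algebra of \<open>(V, \<langle>_,_\<rangle>)\<close> with \<open>v\<^sup>2 = - \<langle>v,v\<rangle>\<close>, a
  module over it is the same thing as a linear map \<open>c\<close> from \<open>V\<close> to endomorphisms (Clifford
  multiplication by vectors) satisfying this relation; submodules are the subspaces stable under
  all \<open>c v\<close>.\<close>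

definition clifford_module ::
    "('v::real_vector \<Rightarrow> 'v \<Rightarrow> real) \<Rightarrow> ('v \<Rightarrow> ('s::euclidean_space \<Rightarrow>\<^sub>L 's)) \<Rightarrow> bool" where
  "clifford_module g c \<longleftrightarrow> linear c \<and> (\<forall>v. c v o\<^sub>L c v = (- g v v) *\<^sub>R id_blinfun)"

definition irreducible_module :: "('v \<Rightarrow> ('s::euclidean_space \<Rightarrow>\<^sub>L 's)) \<Rightarrow> bool" where
  "irreducible_module c \<longleftrightarrow>
     (\<forall>W. subspace W \<and> (\<forall>v. \<forall>x\<in>W. c v x \<in> W) \<longrightarrow> W = {0} \<or> W = UNIV)"

definition orthonormal_frame :: "'e::euclidean_space list \<Rightarrow> bool" where
  "orthonormal_frame us \<longleftrightarrow> length us = DIM('e) \<and>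
     (\<forall>i<DIM('e). \<forall>j<DIM('e). einner (us ! i) (us ! j) = (if i = j then -1 else 0))"

text \<open>The action \<open>c (us!0) \<circ> c (us!1) \<circ> \<dots>\<close> of the volume form for the orientation given by the
  orthonormal frame \<open>us\<close>.\<close>

definition volume_action ::
    "('e \<Rightarrow> ('s::euclidean_space \<Rightarrow>\<^sub>L 's)) \<Rightarrow> 'e list \<Rightarrow> ('s \<Rightarrow>\<^sub>L 's)" where
  "volume_action c us = foldr (\<lambda>u A. c u o\<^sub>L A) us id_blinfun"

text \<open>For an involution \<open>\<omega>\<close>, the eigenspace \<open>S^\<plusminus>\<close> (\<open>\<epsilon> = \<plusminus> 1\<close>) and the projection \<open>\<pi>^\<plusminus>\<close> onto it along
  the other eigenspace.\<close>

definition semispinors :: "('s::euclidean_space \<Rightarrow>\<^sub>L 's) \<Rightarrow> real \<Rightarrow> 's set" where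
  "semispinors \<omega> \<epsilon> = {x. \<omega> x = \<epsilon> *\<^sub>R x}"

definition semispinor_proj :: "('s::euclidean_space \<Rightarrow>\<^sub>L 's) \<Rightarrow> real \<Rightarrow> ('s \<Rightarrow>\<^sub>L 's)" where
  "semispinor_proj \<omega> \<epsilon> = (1/2) *\<^sub>R (id_blinfun + \<epsilon> *\<^sub>R \<omega>)"

lemma semispinor_proj:
  assumes "\<omega> o\<^sub>L \<omega> = id_blinfun" and "\<epsilon> = 1 \<or> \<epsilon> = -1"
  shows "semispinor_proj \<omega> \<epsilon> x \<in> semispinors \<omega> \<epsilon>"
    and "x \<in> semispinors \<omega> \<epsilon> \<Longrightarrow> semispinor_proj \<omega> \<epsilon> x = x"
    and "x \<in> semispinors \<omega> (- \<epsilon>) \<Longrightarrow> semispinor_proj \<omega> \<epsilon> x = 0"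
proof -
  have w: "\<omega> (\<omega> x) = x" for x
    by (metis assms(1) blinfun_apply_blinfun_compose blinfun_apply_id_blinfun)
  show "semispinor_proj \<omega> \<epsilon> x \<in> semispinors \<omega> \<epsilon>"
    using assms(2) by (auto simp: semispinor_proj_def semispinors_def blinfun.add_left
      blinfun.scaleR_left blinfun.add_right blinfun.scaleR_right blinfun.diff_left blinfun.diff_right
      blinfun.minus_left blinfun.minus_right w algebra_simps)
  show "x \<in> semispinors \<omega> \<epsilon> \<Longrightarrow> semispinor_proj \<omega> \<epsilon> x = x"
    using assms(2) by (auto simp: semispinor_proj_def semispinors_def blinfun.add_left
      blinfun.scaleR_left scaleR_2[symmetric] blinfun.minus_left)
  show "x \<in> semispinors \<omega> (- \<epsilon>) \<Longrightarrow> semispinor_proj \<omega> \<epsilon> x = 0"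
    using assms(2) by (auto simp: semispinor_proj_def semispinors_def blinfun.add_left
      blinfun.scaleR_left blinfun.minus_left)
qed

text \<open>Block endomorphisms of \<open>S = S_- + S_+ = S_{0,8} + S_{0,8}\<close>; the first component of the product
  is \<open>S_-\<close>.\<close>

definition block :: "('s::euclidean_space \<Rightarrow>\<^sub>L 's) \<Rightarrow> ('s \<Rightarrow>\<^sub>L 's) \<Rightarrow> ('s \<Rightarrow>\<^sub>L 's) \<Rightarrow> ('s \<Rightarrow>\<^sub>L 's)
    \<Rightarrow> (('s \<times> 's) \<Rightarrow>\<^sub>L ('s \<times> 's))" where
  "block a11 a12 a21 a22 = Blinfun (\<lambda>(x, y). (a11 x + a12 y, a21 x + a22 y))"

lemma block_apply [simp]:
  "blinfun_apply (block a11 a12 a21 a22) z = (a11 (fst z) + a12 (snd z), a21 (fst z) + a22 (snd z))"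
proof -
  have "linear (\<lambda>(x, y). (a11 x + a12 y, a21 x + a22 y))"
    by (rule linearI) (auto simp: blinfun.add_right blinfun.scaleR_right algebra_simps)
  then show ?thesis
    by (simp add: block_def linear_conv_bounded_linear bounded_linear_Blinfun_apply
        split: prod.splits)
qed

text \<open>The bivector \<open>u \<and> v\<close> is the endomorphism \<open>w \<mapsto> \<langle>u,w\<rangle> v - \<langle>v,w\<rangle> u\<close> in \<open>so(m)\<close>. With this
  convention \<open>flat e\<close> acts on \<open>m\<close> through the bracket as \<open>p \<and> B e\<close>.\<close>

definition wedge_act :: "'e::euclidean_space minkowski \<Rightarrow> 'e minkowski \<Rightarrow> 'e minkowski \<Rightarrow> 'e minkowski"
  where "wedge_act u v w = minner u w *\<^sub>R v - minner v w *\<^sub>R u"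

lemma cw_isotropy:
  assumes "bilinear b"
  shows "cw_bracket b (in_h (flat e)) (in_m w) = in_m (wedge_act vec_p (vec_E (cw_endo b e)) w)"
  using cw_endo[OF assms, of e]
  by (auto simp: linear_0[OF linear_flat] linear_0[OF linear_sharp] linear_0[OF linear_cw_endo[OF assms]]
      bilinear_lzero[OF assms] cw_bracket_def in_h_def in_m_def wedge_act_def vec_p_def vec_E_def minner_def
      einner_def zero_prod_def split: prod.splits)

definition spin_action :: "('m \<Rightarrow> ('s::euclidean_space \<Rightarrow>\<^sub>L 's)) \<Rightarrow> 'm \<Rightarrow> 'm \<Rightarrow> ('s \<Rightarrow>\<^sub>L 's)" where
  "spin_action \<gamma> u v = (1/4) *\<^sub>R ((\<gamma> u o\<^sub>L \<gamma> v) - (\<gamma> v o\<^sub>L \<gamma> u))"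

text \<open>\<open>spin_module c \<gamma>\<close>: \<open>\<gamma>\<close> makes \<open>S = S_{0,8} + S_{0,8}\<close> the irreducible module \<open>S_{1,9}\<close> of the
  Clifford algebra of \<open>m\<close>, and the identification of \<open>S\<close> with \<open>S_{0,8} + S_{0,8}\<close> is such that
  \<open>p \<and> e\<close> acts in the prescribed way.\<close>

definition spin_module :: "('e::euclidean_space \<Rightarrow> ('s::euclidean_space \<Rightarrow>\<^sub>L 's)) \<Rightarrow>
    ('e minkowski \<Rightarrow> (('s \<times> 's) \<Rightarrow>\<^sub>L ('s \<times> 's))) \<Rightarrow> bool" where
  "spin_module c \<gamma> \<longleftrightarrow>
     clifford_module minner \<gamma> \<and> irreducible_module \<gamma> \<and>
     (\<forall>e. spin_action \<gamma> vec_p (vec_E e) = block 0 (sqrt 2 *\<^sub>R c e) 0 0)"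

text \<open>For the block form of the defining condition see \<open>spin_representation_block\<close> below.\<close>

definition spin_representation :: "('e::euclidean_space \<Rightarrow> 'e \<Rightarrow> real) \<Rightarrow>
    ('e minkowski \<Rightarrow> (('s::euclidean_space \<times> 's) \<Rightarrow>\<^sub>L ('s \<times> 's))) \<Rightarrow>
    ('e cw \<Rightarrow> (('s \<times> 's) \<Rightarrow>\<^sub>L ('s \<times> 's))) \<Rightarrow> bool" where
  "spin_representation b \<gamma> \<rho> \<longleftrightarrow>
     lie_representation (cw_bracket b) \<rho> \<and>
     (\<forall>e. \<rho> (in_h (flat e)) = spin_action \<gamma> vec_p (vec_E (cw_endo b e)))"

lemma spin_representation_block:
  assumes "spin_module c \<gamma>"
  shows "spin_representation b \<gamma> \<rho> \<longleftrightarrow>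
     lie_representation (cw_bracket b) \<rho> \<and>
     (\<forall>e. \<rho> (in_h (flat e)) = block 0 (sqrt 2 *\<^sub>R c (cw_endo b e)) 0 0)"
  using assms by (simp add: spin_representation_def spin_module_def)

definition nonzero_charge :: "('e::euclidean_space cw \<Rightarrow> ('v::euclidean_space \<Rightarrow>\<^sub>L 'v)) \<Rightarrow> bool" where
  "nonzero_charge \<rho> \<longleftrightarrow> \<rho> (in_m vec_p) \<noteq> 0"

text \<open>The spin action is compatible with Clifford multiplication, which fixes its normalization.\<close>

lemma clifford_anticommute:
  assumes "clifford_module minner \<gamma>"
  shows "\<gamma> u (\<gamma> v x) + \<gamma> v (\<gamma> u x) = (- 2 * minner u v) *\<^sub>R x"
proof -
  have lin: "linear \<gamma>" and sq': "\<gamma> w o\<^sub>L \<gamma> w = (- minner w w) *\<^sub>R id_blinfun" for w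
    using assms unfolding clifford_module_def by blast+
  have sq: "\<gamma> w (\<gamma> w x) = (- minner w w) *\<^sub>R x" for w x
    using arg_cong[OF sq'[of w], of "\<lambda>f. blinfun_apply f x"]
    by (simp add: blinfun.scaleR_left blinfun.minus_left)
  have mm: "minner (u + v) (u + v) = minner u u + minner v v + 2 * minner u v"
    by (auto simp: minner_def einner_def inner_add_left inner_add_right inner_commute algebra_simps
        split: prod.splits)
  show ?thesis
  proof -
    have "\<gamma> (u + v) (\<gamma> (u + v) x)
        = \<gamma> u (\<gamma> u x) + \<gamma> v (\<gamma> v x) + (\<gamma> u (\<gamma> v x) + \<gamma> v (\<gamma> u x))"
      by (simp add: linear_add[OF lin] blinfun.add_left blinfun.add_right)
    then have "\<gamma> u (\<gamma> v x) + \<gamma> v (\<gamma> u x)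
        = (- minner (u + v) (u + v)) *\<^sub>R x - (- minner u u) *\<^sub>R x - (- minner v v) *\<^sub>R x"
      unfolding sq by simp
    also have "\<dots> = (- 2 * minner u v) *\<^sub>R x"
      unfolding mm by (simp add: algebra_simps)
    finally show ?thesis .
  qed
qed

lemma spin_action_equivariant:
  assumes "clifford_module minner \<gamma>"
  shows "(spin_action \<gamma> u v o\<^sub>L \<gamma> w) - (\<gamma> w o\<^sub>L spin_action \<gamma> u v) = \<gamma> (wedge_act u v w)"
proof (rule blinfun_eqI)
  fix x
  have lin: "linear \<gamma>" using assms by (simp add: clifford_module_def)
  note ac = clifford_anticommute[OF assms]
  define U where "U = blinfun_apply (\<gamma> u)"
  define V where "V = blinfun_apply (\<gamma> v)"
  define W where "W = blinfun_apply (\<gamma> w)"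
  note lins = blinfun.add_right blinfun.scaleR_right blinfun.diff_right blinfun.minus_right
  have 1: "V (W x) = (- 2 * minner v w) *\<^sub>R x - W (V x)"
    and 2: "U (W x) = (- 2 * minner u w) *\<^sub>R x - W (U x)"
    and 3: "U (W y) = (- 2 * minner u w) *\<^sub>R y - W (U y)"
    and 4: "V (W y) = (- 2 * minner v w) *\<^sub>R y - W (V y)" for y
    unfolding U_def V_def W_def using ac by (simp_all add: eq_diff_eq)
  have 5: "U (V (W x)) = (- 2 * minner v w) *\<^sub>R U x + (2 * minner u w) *\<^sub>R V x + W (U (V x))"
    unfolding 1 using 3[of "V x"] by (simp add: U_def lins)
  have 6: "V (U (W x)) = (- 2 * minner u w) *\<^sub>R V x + (2 * minner v w) *\<^sub>R U x + W (V (U x))"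
    unfolding 2 using 4[of "U x"] by (simp add: V_def lins)
  have "((spin_action \<gamma> u v o\<^sub>L \<gamma> w) - (\<gamma> w o\<^sub>L spin_action \<gamma> u v)) x =
      (1/4) *\<^sub>R (U (V (W x)) - V (U (W x))) - (1/4) *\<^sub>R (W (U (V x)) - W (V (U x)))"
    by (simp add: spin_action_def U_def V_def W_def blinfun.diff_left blinfun.scaleR_left lins)
  also have "\<dots> = minner u w *\<^sub>R V x - minner v w *\<^sub>R U x"
    unfolding 5 6 by (simp add: algebra_simps flip: scaleR_add_left)
  also have "\<dots> = \<gamma> (wedge_act u v w) x"
    by (simp add: wedge_act_def U_def V_def linear_diff[OF lin] linear_scale[OF lin]
      blinfun.diff_left blinfun.scaleR_left)
  finally show "((spin_action \<gamma> u v o\<^sub>L \<gamma> w) - (\<gamma> w o\<^sub>L spin_action \<gamma> u v)) x = \<gamma> (wedge_act u v w) x" .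
qed

text \<open>Every irreducible module \<open>c\<close> of the Clifford algebra of \<open>E\<close> gives such a \<open>spin_module\<close>.\<close>

lemma spin_module_exists:
  fixes c :: "'e::euclidean_space \<Rightarrow> ('s::euclidean_space \<Rightarrow>\<^sub>L 's)"
  assumes cl: "clifford_module einner c" and irr: "irreducible_module c"
  shows "\<exists>\<gamma>. spin_module c \<gamma>"
proof -
  define \<gamma> :: "'e minkowski \<Rightarrow> (('s \<times> 's) \<Rightarrow>\<^sub>L ('s \<times> 's))" where
    "\<gamma> = (\<lambda>(e, s, t). block (- c e) ((2 * sqrt 2 * s) *\<^sub>R id_blinfun)
                           ((- t / sqrt 2) *\<^sub>R id_blinfun) (c e))"
  have lin: "linear c" and sq': "c e o\<^sub>L c e = (- einner e e) *\<^sub>R id_blinfun" for e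
    using cl unfolding clifford_module_def by blast+
  have sq: "c e (c e x) = (e \<bullet> e) *\<^sub>R x" for e x
    using arg_cong[OF sq'[of e], of "\<lambda>f. blinfun_apply f x"]
    by (simp add: blinfun.scaleR_left einner_def)
  have ap: "\<gamma> (e, s, t) (x, y) = (- c e x + (2 * sqrt 2 * s) *\<^sub>R y, (- t / sqrt 2) *\<^sub>R x + c e y)"
    for e s t x y
    by (simp add: \<gamma>_def blinfun.minus_left blinfun.scaleR_left)
  have "linear \<gamma>"
  proof (rule linearI)
    fix u v :: "'e minkowski" and r :: real
    obtain e s t where u: "u = (e, s, t)" by (metis prod_cases3)
    obtain e' s' t' where v: "v = (e', s', t')" by (metis prod_cases3)
    show "\<gamma> (u + v) = \<gamma> u + \<gamma> v"
      by (rule blinfun_eqI) (auto simp: u v ap blinfun.add_left linear_add[OF lin]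
          add_divide_distrib diff_divide_distrib algebra_simps)
    show "\<gamma> (r *\<^sub>R u) = r *\<^sub>R \<gamma> u"
      by (rule blinfun_eqI) (auto simp: u ap blinfun.scaleR_left linear_scale[OF lin]
          algebra_simps)
  qed
  moreover have "\<gamma> v o\<^sub>L \<gamma> v = (- minner v v) *\<^sub>R id_blinfun" for v
  proof -
    obtain e s t where v: "v = (e, s, t)" by (metis prod_cases3)
    show ?thesis
      by (rule blinfun_eqI) (auto simp: v ap blinfun.scaleR_left blinfun.add_right
          blinfun.scaleR_right blinfun.minus_right blinfun.diff_right blinfun.diff_left
          sq minner_def einner_def algebra_simps)
  qed
  moreover have "irreducible_module \<gamma>"
    unfolding irreducible_module_def
  proof (intro allI impI)
    fix W :: "('s \<times> 's) set"
    assume A: "subspace W \<and> (\<forall>v. \<forall>x\<in>W. \<gamma> v x \<in> W)"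
    then have sW: "subspace W" and inv: "\<And>v x. x \<in> W \<Longrightarrow> \<gamma> v x \<in> W" by auto
    define W1 where "W1 = {x. (x, 0) \<in> W}"
    have up: "(y, 0) \<in> W" if "(x, y) \<in> W" for x y
    proof -
      have "(1 / (2 * sqrt 2)) *\<^sub>R \<gamma> (0, 1, 0) (x, y) \<in> W"
        using that inv sW by (intro subspace_scale) auto
      then show ?thesis by (simp add: ap linear_0[OF lin])
    qed
    have down: "(0, x) \<in> W" if "(x, y) \<in> W" for x y
    proof -
      have "(- sqrt 2) *\<^sub>R \<gamma> (0, 0, 1) (x, y) \<in> W"
        using that inv sW by (intro subspace_scale) auto
      then show ?thesis by (simp add: ap linear_0[OF lin])
    qed
    have W: "W = W1 \<times> W1"
    proof (intro set_eqI iffI)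
      fix z assume z: "z \<in> W"
      obtain x y where xy: "z = (x, y)" by (cases z)
      have "(x, 0) \<in> W" using z up[OF down] xy by blast
      moreover have "(y, 0) \<in> W" using z up xy by blast
      ultimately show "z \<in> W1 \<times> W1" by (simp add: W1_def xy)
    next
      fix z assume "z \<in> W1 \<times> W1"
      then obtain x y where xy: "z = (x, y)" "(x, 0) \<in> W" "(y, 0) \<in> W" by (auto simp: W1_def)
      have "(x, 0) + (0, y) \<in> W" using xy down sW by (intro subspace_add) auto
      then show "z \<in> W" by (simp add: xy)
    qed
    have "subspace W1"
      using subspace_0[OF sW] subspace_add[OF sW] subspace_scale[OF sW]
      by (intro subspaceI) (force simp: W1_def zero_prod_def)+
    moreover have "c v x \<in> W1" if "x \<in> W1" for v x
    proof -
      have "(- 1) *\<^sub>R \<gamma> (v, 0, 0) (x, 0) \<in> W"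
        using that inv sW by (intro subspace_scale) (auto simp: W1_def)
      then show ?thesis by (simp add: ap W1_def)
    qed
    ultimately have "W1 = {0} \<or> W1 = UNIV"
      using irr by (auto simp: irreducible_module_def)
    then show "W = {0} \<or> W = UNIV" by (auto simp: W zero_prod_def)
  qed
  moreover have "spin_action \<gamma> vec_p (vec_E e) = block 0 (sqrt 2 *\<^sub>R c e) 0 0" for e
    by (rule blinfun_eqI) (auto simp: spin_action_def vec_p_def vec_E_def ap linear_0[OF lin]
        blinfun.diff_left blinfun.scaleR_left blinfun.scaleR_right blinfun.minus_right
        blinfun.minus_left scaleR_2[symmetric] algebra_simps simp flip: scaleR_add_left)
  ultimately show ?thesis by (auto simp: spin_module_def clifford_module_def)
qed

end

theory Submission
  imports Defs
begin

text \<open>Write \<open>\<rho>(q)\<close> as a block matrix with rows \<open>L, N\<close> and \<open>K, M\<close>. The brackets with \<open>E^*\<close>, on which \<open>\<rho>\<close> is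
  prescribed, express everything else by these four blocks: \<open>\<rho>(e)\<close> has rows \<open>e K, e M - L e\<close> and
  \<open>0, - K e\<close> up to the factor \<open>\<surd>2\<close>, and \<open>\<rho>(p)\<close> is \<open>-4 T\<close> in the upper right corner, where \<open>e K e = T\<close> for
  all unit vectors \<open>e\<close>. So a representation of nonzero charge has \<open>K \<noteq> 0\<close>, and Clifford multiplication
  by vectors exchanges \<open>K\<close> and \<open>T\<close>, exactly as it exchanges the two projections onto semi-spinors.

  This analogy is what makes the argument work. Commutativity of the \<open>\<rho>(e)\<close> gives \<open>T K = K T = 0\<close>, and
  irreducibility gives that \<open>K + T\<close> is invertible (\<open>twist_sum_inverse\<close>), so \<open>K\<close> and \<open>T\<close> are multiples of
  complementary projections by an invertible operator commuting with the Clifford action. The remaining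
  relation \<open>[q, e] = e^\<flat>\<close> expresses \<open>B e\<close> by the blocks, and compressing \<open>(B e) e + e (B e) = 2 (B e \<bullet> e)\<close>
  to the image of \<open>K\<close> yields an operator that is the same for all unit vectors \<open>e\<close>
  (\<open>charge_forces_scalar\<close>). Therefore the quadratic form of the symmetric endomorphism \<open>B\<close> is constant on
  the unit sphere and \<open>B = \<mu> Id\<close>; the normalization of the eigenvalues leaves \<open>\<mu> = \<plusminus>1\<close>.

  Conversely, in dimension eight the volume form is an involution anticommuting with vectors, so
  honest semi-spinor projections exist, and taking \<open>K = - \<pi>^-\<close>, \<open>L = M = 0\<close>, \<open>N = \<plusminus>Id\<close> satisfies all
  relations (\<open>half_spin_representation\<close>). Its charge \<open>4 \<pi>^+\<close> is not zero, since vectors exchange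
  \<open>\<pi>^+\<close> and \<open>\<pi>^-\<close>.\<close>

section \<open>Block endomorphisms\<close>

lemma block_decomposition:
  fixes A :: "('s::euclidean_space \<times> 's) \<Rightarrow>\<^sub>L ('s \<times> 's)"
  obtains L N K M where "A = block L N K M"
proof
  let ?A = "blinfun_apply A"
  have lin: "bounded_linear (\<lambda>x. fst (?A (x, 0)))" "bounded_linear (\<lambda>x. fst (?A (0, x)))"
    "bounded_linear (\<lambda>x. snd (?A (x, 0)))" "bounded_linear (\<lambda>x. snd (?A (0, x)))"
    by (intro bounded_linear_fst_comp bounded_linear_snd_comp blinfun.bounded_linear_right
        bounded_linear_compose[OF blinfun.bounded_linear_right] bounded_linear_Pair
        bounded_linear_ident bounded_linear_zero)+
  have split: "?A (x, y) = ?A (x, 0) + ?A (0, y)" for x y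
    by (simp flip: blinfun.add_right)
  show "A = block (Blinfun (\<lambda>x. fst (?A (x, 0)))) (Blinfun (\<lambda>x. fst (?A (0, x))))
                  (Blinfun (\<lambda>x. snd (?A (x, 0)))) (Blinfun (\<lambda>x. snd (?A (0, x))))"
  proof (rule blinfun_eqI)
    fix z
    show "?A z = block (Blinfun (\<lambda>x. fst (?A (x, 0)))) (Blinfun (\<lambda>x. fst (?A (0, x))))
                  (Blinfun (\<lambda>x. snd (?A (x, 0)))) (Blinfun (\<lambda>x. snd (?A (0, x)))) z"
      using split[of "fst z" "snd z"] by (simp add: lin bounded_linear_Blinfun_apply prod_eq_iff)
  qed
qed

lemma block_eq_iff:
  "block a11 a12 a21 a22 = block b11 b12 b21 b22 \<longleftrightarrow> a11 = b11 \<and> a12 = b12 \<and> a21 = b21 \<and> a22 = b22"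
  (is "?A = ?B \<longleftrightarrow> _")
proof
  assume "?A = ?B"
  then have *: "?A (x, 0) = ?B (x, 0)" "?A (0, x) = ?B (0, x)" for x by auto
  show "a11 = b11 \<and> a12 = b12 \<and> a21 = b21 \<and> a22 = b22"
    using *  by (auto intro!: blinfun_eqI)
qed simp

lemma block_compose:
  "block a11 a12 a21 a22 o\<^sub>L block b11 b12 b21 b22 =
   block ((a11 o\<^sub>L b11) + (a12 o\<^sub>L b21)) ((a11 o\<^sub>L b12) + (a12 o\<^sub>L b22))
         ((a21 o\<^sub>L b11) + (a22 o\<^sub>L b21)) ((a21 o\<^sub>L b12) + (a22 o\<^sub>L b22))"
  by (rule blinfun_eqI) (simp add: blinfun.add_left blinfun.add_right)

lemma block_linear:
  "block a11 a12 a21 a22 + block b11 b12 b21 b22 =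
    block (a11 + b11) (a12 + b12) (a21 + b21) (a22 + b22)"
  "block a11 a12 a21 a22 - block b11 b12 b21 b22 =
    block (a11 - b11) (a12 - b12) (a21 - b21) (a22 - b22)"
  "r *\<^sub>R block a11 a12 a21 a22 = block (r *\<^sub>R a11) (r *\<^sub>R a12) (r *\<^sub>R a21) (r *\<^sub>R a22)"
  "block 0 0 0 0 = 0"
  by (rule blinfun_eqI, simp add: blinfun.add_left blinfun.diff_left blinfun.scaleR_left
      scaleR_right_distrib prod_eq_iff)+

lemmas compose_bilinear =
  bounded_bilinear.add_left[OF bounded_bilinear_blinfun_compose]
  bounded_bilinear.add_right[OF bounded_bilinear_blinfun_compose]
  bounded_bilinear.diff_left[OF bounded_bilinear_blinfun_compose]
  bounded_bilinear.diff_right[OF bounded_bilinear_blinfun_compose]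
  bounded_bilinear.minus_left[OF bounded_bilinear_blinfun_compose]
  bounded_bilinear.minus_right[OF bounded_bilinear_blinfun_compose]
  bounded_bilinear.scaleR_left[OF bounded_bilinear_blinfun_compose]
  bounded_bilinear.scaleR_right[OF bounded_bilinear_blinfun_compose]
  bounded_bilinear.zero_left[OF bounded_bilinear_blinfun_compose]
  bounded_bilinear.zero_right[OF bounded_bilinear_blinfun_compose]

lemma compose_assoc: "(A o\<^sub>L B) o\<^sub>L C = A o\<^sub>L (B o\<^sub>L C)"
  by (rule blinfun_eqI) simp

lemma compose_id: "id_blinfun o\<^sub>L A = A" "A o\<^sub>L id_blinfun = A"
  by (rule blinfun_eqI, simp)+

section \<open>Representations of the Cahen-Wallach algebra by generators\<close>

lemma cw_representation_relations:
  assumes b: "bilinear b" and rep: "lie_representation (cw_bracket b) \<rho>"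
  shows "(\<rho> (in_m vec_q) o\<^sub>L \<rho> (in_m (vec_E e))) - (\<rho> (in_m (vec_E e)) o\<^sub>L \<rho> (in_m vec_q))
           = \<rho> (in_h (flat e))"
    and "(\<rho> (in_h (flat e)) o\<^sub>L \<rho> (in_m (vec_E f))) - (\<rho> (in_m (vec_E f)) o\<^sub>L \<rho> (in_h (flat e)))
           = b e f *\<^sub>R \<rho> (in_m vec_p)"
    and "(\<rho> (in_h (flat e)) o\<^sub>L \<rho> (in_m vec_q)) - (\<rho> (in_m vec_q) o\<^sub>L \<rho> (in_h (flat e)))
           = \<rho> (in_m (vec_E (cw_endo b e)))"
    and "\<rho> (in_m (vec_E e)) o\<^sub>L \<rho> (in_m (vec_E f)) = \<rho> (in_m (vec_E f)) o\<^sub>L \<rho> (in_m (vec_E e))"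
proof -
  have br: "(\<rho> x o\<^sub>L \<rho> y) - (\<rho> y o\<^sub>L \<rho> x) = \<rho> (cw_bracket b x y)" and lin: "linear \<rho>" for x y
    using rep unfolding lie_representation_def by metis+
  have p: "in_m (r *\<^sub>R vec_p) = r *\<^sub>R in_m (vec_p :: 'a minkowski)" for r
    by (simp add: in_m_def)
  show "(\<rho> (in_m vec_q) o\<^sub>L \<rho> (in_m (vec_E e))) - (\<rho> (in_m (vec_E e)) o\<^sub>L \<rho> (in_m vec_q))
           = \<rho> (in_h (flat e))"
    and "(\<rho> (in_h (flat e)) o\<^sub>L \<rho> (in_m (vec_E f))) - (\<rho> (in_m (vec_E f)) o\<^sub>L \<rho> (in_h (flat e)))
           = b e f *\<^sub>R \<rho> (in_m vec_p)"
    and "(\<rho> (in_h (flat e)) o\<^sub>L \<rho> (in_m vec_q)) - (\<rho> (in_m vec_q) o\<^sub>L \<rho> (in_h (flat e)))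
           = \<rho> (in_m (vec_E (cw_endo b e)))"
    by (simp_all add: br cw_bracket_generators[OF b] p linear_scale[OF lin])
  have "(\<rho> (in_m (vec_E e)) o\<^sub>L \<rho> (in_m (vec_E f))) - (\<rho> (in_m (vec_E f)) o\<^sub>L \<rho> (in_m (vec_E e))) = 0"
    by (simp add: br cw_bracket_generators[OF b] linear_0[OF lin])
  then show "\<rho> (in_m (vec_E e)) o\<^sub>L \<rho> (in_m (vec_E f)) = \<rho> (in_m (vec_E f)) o\<^sub>L \<rho> (in_m (vec_E e))"
    by simp
qed

text \<open>The bracket of two general elements is a bilinear combination of the brackets of generators, and
\<open>P\<close> is central, so the relations below are all that a representation has to satisfy. This reduces
the verification of the model representation to finitely many block identities.\<close>

lemma cw_representation_from_generators:
  fixes H F :: "'e::euclidean_space \<Rightarrow> ('v::euclidean_space \<Rightarrow>\<^sub>L 'v)" and P Q :: "'v \<Rightarrow>\<^sub>L 'v"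
  assumes b: "bilinear b" and H: "linear H" and F: "linear F"
    and qe: "\<And>e. (Q o\<^sub>L F e) - (F e o\<^sub>L Q) = H e"
    and he: "\<And>e f. (H e o\<^sub>L F f) - (F f o\<^sub>L H e) = b e f *\<^sub>R P"
    and hq: "\<And>e. (H e o\<^sub>L Q) - (Q o\<^sub>L H e) = F (cw_endo b e)"
    and hh: "\<And>e f. H e o\<^sub>L H f = H f o\<^sub>L H e"
    and ee: "\<And>e f. F e o\<^sub>L F f = F f o\<^sub>L F e"
    and ph: "\<And>e. P o\<^sub>L H e = H e o\<^sub>L P"
    and pe: "\<And>e. P o\<^sub>L F e = F e o\<^sub>L P"
    and pq: "P o\<^sub>L Q = Q o\<^sub>L P"
  shows "lie_representation (cw_bracket b) (\<lambda>(\<phi>, e, s, t). H (sharp \<phi>) + F e + s *\<^sub>R P + t *\<^sub>R Q)"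
    (is "lie_representation _ ?\<rho>")
proof -
  note lin = linear_add[OF H] linear_scale[OF H] linear_diff[OF H] linear_add[OF F] linear_scale[OF F]
    linear_diff[OF F] linear_add[OF linear_sharp] linear_scale[OF linear_sharp] linear_diff[OF linear_sharp]
  have qe': "Q o\<^sub>L F e = H e + (F e o\<^sub>L Q)" for e using qe[of e] by (simp add: diff_eq_eq)
  have he': "H e o\<^sub>L F f = b e f *\<^sub>R P + (F f o\<^sub>L H e)" for e f using he[of e f] by (simp add: diff_eq_eq)
  have hq': "H e o\<^sub>L Q = F (cw_endo b e) + (Q o\<^sub>L H e)" for e using hq[of e] by (simp add: diff_eq_eq)
  have "linear ?\<rho>"
    by (rule linearI) (auto simp: lin algebra_simps)
  moreover have "?\<rho> (cw_bracket b x y) = (?\<rho> x o\<^sub>L ?\<rho> y) - (?\<rho> y o\<^sub>L ?\<rho> x)" for x y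
  proof -
    obtain \<phi> e s t where x: "x = (\<phi>, e, s, t)" by (metis prod_cases4)
    obtain \<phi>' e' s' t' where y: "y = (\<phi>', e', s', t')" by (metis prod_cases4)
    have "?\<rho> (cw_bracket b x y) = t *\<^sub>R H e' - t' *\<^sub>R H e + t' *\<^sub>R F (cw_endo b (sharp \<phi>))
        - t *\<^sub>R F (cw_endo b (sharp \<phi>')) + b (sharp \<phi>) e' *\<^sub>R P - b (sharp \<phi>') e *\<^sub>R P"
      by (simp add: x y cw_bracket_def lin algebra_simps)
    also have "\<dots> = (?\<rho> x o\<^sub>L ?\<rho> y) - (?\<rho> y o\<^sub>L ?\<rho> x)"
      by (simp add: x y compose_bilinear qe' he' hq' hh[of "sharp \<phi>'"] ee[of e'] ph pe pq algebra_simps)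
    finally show ?thesis .
  qed
  ultimately show ?thesis by (simp add: lie_representation_def)
qed

section \<open>Clifford multiplication and the volume form\<close>

lemma clifford_square:
  assumes "clifford_module einner c"
  shows "c e o\<^sub>L c e = (e \<bullet> e) *\<^sub>R id_blinfun"
  using assms by (simp add: clifford_module_def einner_def)

lemma clifford_polarized:
  assumes "clifford_module einner c"
  shows "(c e o\<^sub>L c f) + (c f o\<^sub>L c e) = (2 * (e \<bullet> f)) *\<^sub>R id_blinfun"
proof -
  have lin: "linear c" using assms by (simp add: clifford_module_def)
  have "(c e o\<^sub>L c f) + (c f o\<^sub>L c e) = (c (e + f) o\<^sub>L c (e + f)) - (c e o\<^sub>L c e) - (c f o\<^sub>L c f)"
    by (simp add: linear_add[OF lin] compose_bilinear)
  also have "\<dots> = (2 * (e \<bullet> f)) *\<^sub>R id_blinfun"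
    unfolding clifford_square[OF assms] scaleR_diff_left[symmetric]
    by (simp add: inner_add_left inner_add_right inner_commute[of f e])
  finally show ?thesis .
qed

lemma clifford_square_apply:
  assumes "clifford_module einner c"
  shows "c e (c e x) = (e \<bullet> e) *\<^sub>R x"
  using arg_cong[OF clifford_square[OF assms, of e], of "\<lambda>A. blinfun_apply A x"]
  by (simp add: blinfun.scaleR_left)

lemma clifford_polarized_apply:
  assumes "clifford_module einner c"
  shows "c e (c f x) + c f (c e x) = (2 * (e \<bullet> f)) *\<^sub>R x"
  using arg_cong[OF clifford_polarized[OF assms, of e f], of "\<lambda>A. blinfun_apply A x"]
  by (simp add: blinfun.scaleR_left blinfun.add_left)

lemma volume_action_Cons: "volume_action c (u # us) = c u o\<^sub>L volume_action c us"
  by (simp add: volume_action_def)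

lemma volume_action_Nil: "volume_action c [] = id_blinfun"
  by (simp add: volume_action_def)

text \<open>Each factor that \<open>u\<close> passes contributes a sign.\<close>

lemma volume_action_orthogonal:
  assumes "clifford_module einner c" and "\<forall>v\<in>set vs. u \<bullet> v = 0"
  shows "c u o\<^sub>L volume_action c vs = (-1) ^ length vs *\<^sub>R (volume_action c vs o\<^sub>L c u)"
  using assms(2)
proof (induction vs)
  case (Cons v vs)
  have "c u o\<^sub>L c v = - (c v o\<^sub>L c u)"
    using clifford_polarized[OF assms(1), of u v] Cons.prems by (simp add: eq_neg_iff_add_eq_0)
  then have "c u o\<^sub>L volume_action c (v # vs) = - (c v o\<^sub>L (c u o\<^sub>L volume_action c vs))"
    by (simp add: volume_action_Cons compose_bilinear flip: compose_assoc)
  also have "\<dots> = (-1) ^ length (v # vs) *\<^sub>R (volume_action c (v # vs) o\<^sub>L c u)"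
    using Cons by (simp add: volume_action_Cons compose_bilinear compose_assoc)
  finally show ?case .
qed (simp add: volume_action_Nil compose_id)

text \<open>Here \<open>u\<close> occurs among the factors: it commutes with itself and anticommutes with all the others,
which accounts for one sign less than in the orthogonal case.\<close>

lemma volume_action_member:
  assumes "clifford_module einner c" and "distinct vs" and "pairwise (\<lambda>u v. u \<bullet> v = 0) (set vs)"
    and "u \<in> set vs"
  shows "c u o\<^sub>L volume_action c vs = (-1) ^ (length vs - 1) *\<^sub>R (volume_action c vs o\<^sub>L c u)"
  using assms(2-4)
proof (induction vs)
  case (Cons v vs)
  show ?case
  proof (cases "u = v")
    case True
    have "\<forall>w\<in>set vs. v \<bullet> w = 0" using Cons.prems by (auto simp: pairwise_def)
    note this = volume_action_orthogonal[OF assms(1) this]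
    then have "volume_action c vs o\<^sub>L c v = (-1) ^ length vs *\<^sub>R (c v o\<^sub>L volume_action c vs)"
      by (simp flip: power_mult_distrib)
    then show ?thesis by (simp add: True volume_action_Cons compose_assoc compose_bilinear
          flip: power_mult_distrib)
  next
    case False
    then have u: "u \<in> set vs" using Cons.prems by auto
    have "c u o\<^sub>L c v = - (c v o\<^sub>L c u)"
      using clifford_polarized[OF assms(1), of u v] Cons.prems False
      by (simp add: eq_neg_iff_add_eq_0 pairwise_def)
    then have "c u o\<^sub>L volume_action c (v # vs) = - (c v o\<^sub>L (c u o\<^sub>L volume_action c vs))"
      by (simp add: volume_action_Cons compose_bilinear flip: compose_assoc)
    also have "\<dots> = - ((-1) ^ (length vs - 1) *\<^sub>R (volume_action c (v # vs) o\<^sub>L c u))"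
      using Cons u by (simp add: volume_action_Cons compose_bilinear compose_assoc pairwise_insert)
    also have "\<dots> = (-1) ^ (length (v # vs) - 1) *\<^sub>R (volume_action c (v # vs) o\<^sub>L c u)"
      using u by (cases vs) auto
    finally show ?thesis .
  qed
qed simp

text \<open>Squaring a product of \<open>n\<close> anticommuting unit vectors means reversing one copy, which takes
\<open>n choose 2\<close> transpositions, after which everything cancels since unit vectors of a negative definite
space square to \<open>+1\<close>. In dimension 8 the exponent is 28, so the volume form is an involution.\<close>

lemma volume_action_square:
  assumes "clifford_module einner c" and "distinct vs" and "pairwise (\<lambda>u v. u \<bullet> v = 0) (set vs)"
    and "\<forall>v\<in>set vs. v \<bullet> v = 1"
  shows "volume_action c vs o\<^sub>L volume_action c vs = (-1) ^ (length vs choose 2) *\<^sub>R id_blinfun"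
  using assms(2-4)
proof (induction vs)
  case (Cons v vs)
  let ?V = "volume_action c vs"
  have "\<forall>w\<in>set vs. v \<bullet> w = 0" using Cons.prems by (auto simp: pairwise_def)
  note this = volume_action_orthogonal[OF assms(1) this]
  then have "?V o\<^sub>L c v = (-1) ^ length vs *\<^sub>R (c v o\<^sub>L ?V)"
    by (simp flip: power_mult_distrib)
  then have "?V o\<^sub>L (c v o\<^sub>L ?V) = (-1) ^ length vs *\<^sub>R (c v o\<^sub>L (?V o\<^sub>L ?V))"
    by (simp add: compose_bilinear flip: compose_assoc)
  moreover have "c v o\<^sub>L (c v o\<^sub>L A) = A" for A :: "'b \<Rightarrow>\<^sub>L 'b"
    using clifford_square[OF assms(1), of v] Cons.prems by (simp add: compose_id flip: compose_assoc)
  moreover have "?V o\<^sub>L ?V = (-1) ^ (length vs choose 2) *\<^sub>R id_blinfun"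
    using Cons by (simp add: pairwise_insert)
  ultimately show ?case
    by (simp add: volume_action_Cons compose_assoc compose_bilinear power_add numeral_2_eq_2)
qed (simp add: volume_action_Nil compose_id numeral_2_eq_2)

lemma orthonormal_frameD:
  fixes us :: "'e::euclidean_space list"
  assumes "orthonormal_frame us"
  shows "distinct us" "pairwise (\<lambda>u v. u \<bullet> v = 0) (set us)" "\<forall>v\<in>set us. v \<bullet> v = 1"
    "length us = DIM('e)" "span (set us) = UNIV"
proof -
  have ip: "us ! i \<bullet> us ! j = (if i = j then 1 else 0)" if "i < length us" "j < length us" for i j
    using assms that unfolding orthonormal_frame_def einner_def
    by (metis add.inverse_inverse add.inverse_neutral)
  show len: "length us = DIM('e)" using assms by (simp add: orthonormal_frame_def)
  show d: "distinct us" unfolding distinct_conv_nth by (metis ip zero_neq_one)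
  show o: "pairwise (\<lambda>u v. u \<bullet> v = 0) (set us)"
    unfolding pairwise_def by (metis in_set_conv_nth ip)
  show u: "\<forall>v\<in>set us. v \<bullet> v = 1" by (auto simp: in_set_conv_nth ip)
  have "independent (set us)"
    using o u by (intro pairwise_orthogonal_independent) (auto simp: pairwise_def orthogonal_def)
  then show "span (set us) = UNIV"
    using card_eq_dim[of "set us" UNIV] d len by (auto simp: distinct_card)
qed

text \<open>The frame vectors span, so the anticommutation relation, linear in \<open>e\<close>, follows from the case of a
frame vector. Evenness of the dimension makes the number of signs odd.\<close>

lemma volume_action_anticommute:
  fixes c :: "'e::euclidean_space \<Rightarrow> ('s::euclidean_space \<Rightarrow>\<^sub>L 's)"
  assumes c: "clifford_module einner c" and us: "orthonormal_frame us" and even: "even DIM('e)"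
  shows "c e o\<^sub>L volume_action c us = - (volume_action c us o\<^sub>L c e)"
proof -
  have lin: "linear c" using c by (simp add: clifford_module_def)
  note f = orthonormal_frameD[OF us]
  let ?V = "volume_action c us"
  have *: "linear (\<lambda>e. (c e o\<^sub>L ?V) + (?V o\<^sub>L c e))"
    by (rule linearI) (simp_all add: linear_add[OF lin] linear_scale[OF lin] compose_bilinear algebra_simps)
  have odd: "odd (DIM('e) - 1)" using even DIM_positive[where 'a='e] by simp
  have "(c e o\<^sub>L ?V) + (?V o\<^sub>L c e) = 0"
    by (rule linear_eq_0_on_span[OF *, of "set us"])
       (use f odd in \<open>simp_all add: volume_action_member[OF c]\<close>)
  then show ?thesis by (simp add: eq_neg_iff_add_eq_0)
qed

section \<open>The half-spin model for \<open>B = \<plusminus>Id\<close>\<close>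

lemma semispinor_proj_algebra:
  assumes "\<omega> o\<^sub>L \<omega> = id_blinfun"
  shows "semispinor_proj \<omega> 1 o\<^sub>L semispinor_proj \<omega> 1 = semispinor_proj \<omega> 1"
    and "semispinor_proj \<omega> (-1) o\<^sub>L semispinor_proj \<omega> (-1) = semispinor_proj \<omega> (-1)"
    and "semispinor_proj \<omega> 1 o\<^sub>L semispinor_proj \<omega> (-1) = 0"
    and "semispinor_proj \<omega> (-1) o\<^sub>L semispinor_proj \<omega> 1 = 0"
    and "semispinor_proj \<omega> 1 + semispinor_proj \<omega> (-1) = id_blinfun"
  using assms
  by (simp_all add: semispinor_proj_def compose_bilinear compose_id algebra_simps
      flip: scaleR_add_left)

text \<open>An operator anticommuting with the volume form interchanges the two semi-spinor spaces.\<close>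

lemma semispinor_proj_swap:
  assumes "A o\<^sub>L \<omega> = - (\<omega> o\<^sub>L A)"
  shows "semispinor_proj \<omega> \<epsilon> o\<^sub>L A = A o\<^sub>L semispinor_proj \<omega> (- \<epsilon>)"
  using assms by (simp add: semispinor_proj_def compose_bilinear compose_id)

text \<open>The representation of the theorem, written for an arbitrary pair of complementary projections
interchanged by Clifford multiplication. All products of two matrices \<open>\<rho>(e)\<close>, \<open>\<rho>(f)\<close> vanish because
\<open>e \<Pi>m f \<Pi>m = e f \<Pi>p \<Pi>m = 0\<close>. The value of \<open>\<rho>(p)\<close> comes from
\<open>[\<rho>(e^\<flat>), \<rho>(f)] = 2 \<epsilon> (e f + f e) \<Pi>p = 4 \<epsilon> (e \<bullet> f) \<Pi>p\<close> in the upper right corner.\<close>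

lemma half_spin_representation:
  fixes b :: "'e::euclidean_space \<Rightarrow> 'e \<Rightarrow> real" and c :: "'e \<Rightarrow> ('s::euclidean_space \<Rightarrow>\<^sub>L 's)"
    and \<Pi>p \<Pi>m :: "'s \<Rightarrow>\<^sub>L 's"
  assumes b: "bilinear b" and B: "cw_endo b = (\<lambda>x. \<epsilon> *\<^sub>R x)" and \<epsilon>: "\<epsilon> = 1 \<or> \<epsilon> = -1"
    and c: "clifford_module einner c"
    and proj: "\<Pi>p o\<^sub>L \<Pi>p = \<Pi>p" "\<Pi>m o\<^sub>L \<Pi>m = \<Pi>m" "\<Pi>p o\<^sub>L \<Pi>m = 0" "\<Pi>m o\<^sub>L \<Pi>p = 0" "\<Pi>p + \<Pi>m = id_blinfun"
    and swap: "\<And>e. \<Pi>p o\<^sub>L c e = c e o\<^sub>L \<Pi>m" "\<And>e. \<Pi>m o\<^sub>L c e = c e o\<^sub>L \<Pi>p"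
  shows "lie_representation (cw_bracket b) (\<lambda>(\<phi>, e, s, t).
      block 0 (sqrt 2 *\<^sub>R c (\<epsilon> *\<^sub>R sharp \<phi>)) 0 0
      + block (- (sqrt 2 *\<^sub>R (c e o\<^sub>L \<Pi>m))) 0 0 (sqrt 2 *\<^sub>R (c e o\<^sub>L \<Pi>p))
      + s *\<^sub>R block 0 (4 *\<^sub>R \<Pi>p) 0 0 + t *\<^sub>R block 0 (\<epsilon> *\<^sub>R id_blinfun) (- \<Pi>m) 0)"
    (is "lie_representation _ (\<lambda>(\<phi>, e, s, t). ?H (sharp \<phi>) + ?F e + s *\<^sub>R ?P + t *\<^sub>R ?Q)")
proof -
  have lin: "linear c" using c by (simp add: clifford_module_def)
  note lins = linear_add[OF lin] linear_scale[OF lin]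
  have swap': "\<Pi>p o\<^sub>L (c e o\<^sub>L A) = c e o\<^sub>L (\<Pi>m o\<^sub>L A)" "\<Pi>m o\<^sub>L (c e o\<^sub>L A) = c e o\<^sub>L (\<Pi>p o\<^sub>L A)"
    for e and A :: "'s \<Rightarrow>\<^sub>L 's" using swap by (metis compose_assoc)+
  have anti: "(c e o\<^sub>L (c f o\<^sub>L A)) + (c f o\<^sub>L (c e o\<^sub>L A)) = (2 * (e \<bullet> f)) *\<^sub>R A" for e f and A :: "'s \<Rightarrow>\<^sub>L 's"
    using arg_cong[OF clifford_polarized[OF c, of e f], of "\<lambda>X. X o\<^sub>L A"]
    by (simp add: compose_bilinear compose_assoc compose_id)
  have bform: "b e f = \<epsilon> * (e \<bullet> f)" for e f
    using cw_endo[OF b, of e f] by (simp add: B einner_def)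
  have split: "(c e o\<^sub>L \<Pi>p) + (c e o\<^sub>L \<Pi>m) = c e" for e
    by (simp add: compose_id proj(5) flip: compose_bilinear(2))
  \<comment> \<open>Products are normalised by associating to the right and moving projections to the far right.\<close>
  note calc = block_compose block_linear block_eq_iff compose_bilinear compose_assoc compose_id
    proj(1-4) swap swap' B lins
  show ?thesis
  proof (rule cw_representation_from_generators[OF b, where H = ?H and F = ?F])
    show "linear ?H" by (rule linearI) (simp_all add: calc algebra_simps)
    show "linear ?F" by (rule linearI) (simp_all add: calc algebra_simps)
    fix e f :: 'e
    show "(?Q o\<^sub>L ?F e) - (?F e o\<^sub>L ?Q) = ?H e"
      using split[of e] by (simp add: calc) (simp add: algebra_simps flip: scaleR_add_right)
    show "(?H e o\<^sub>L ?F f) - (?F f o\<^sub>L ?H e) = b e f *\<^sub>R ?P"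
    proof -
      have "(2 * \<epsilon>) *\<^sub>R ((c e o\<^sub>L (c f o\<^sub>L \<Pi>p)) + (c f o\<^sub>L (c e o\<^sub>L \<Pi>p))) = (4 * (\<epsilon> * (e \<bullet> f))) *\<^sub>R \<Pi>p"
        unfolding anti by simp
      then show ?thesis by (simp add: calc bform algebra_simps)
    qed
    show "(?H e o\<^sub>L ?Q) - (?Q o\<^sub>L ?H e) = ?F (cw_endo b e)" by (simp add: calc)
    show "?H e o\<^sub>L ?H f = ?H f o\<^sub>L ?H e" "?F e o\<^sub>L ?F f = ?F f o\<^sub>L ?F e" "?P o\<^sub>L ?H e = ?H e o\<^sub>L ?P"
      "?P o\<^sub>L ?F e = ?F e o\<^sub>L ?P" "?P o\<^sub>L ?Q = ?Q o\<^sub>L ?P"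
      by (simp_all add: calc)
  qed
qed

section \<open>Nonzero charge forces a scalar form\<close>

text \<open>A symmetric endomorphism is determined by its quadratic form, by polarization.\<close>

lemma scalar_of_constant_quadratic_form:
  fixes B :: "'e::euclidean_space \<Rightarrow> 'e"
  assumes lin: "linear B" and sym: "\<And>x y. B x \<bullet> y = x \<bullet> B y"
    and const: "\<And>x y. norm x = 1 \<Longrightarrow> norm y = 1 \<Longrightarrow> B x \<bullet> x = B y \<bullet> y"
  obtains \<mu> where "B = (\<lambda>x. \<mu> *\<^sub>R x)"
proof -
  obtain u :: 'e where u: "norm u = 1" by (metis nonempty_Basis norm_Basis ex_in_conv)
  define \<mu> where "\<mu> = B u \<bullet> u"
  have q: "B x \<bullet> x = \<mu> * (x \<bullet> x)" for x
  proof (cases "x = 0")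
    case False
    then have "B (x /\<^sub>R norm x) \<bullet> (x /\<^sub>R norm x) = \<mu>" unfolding \<mu>_def by (intro const) (auto simp: u)
    then show ?thesis using False
      by (simp add: linear_scale[OF lin] field_simps power2_norm_eq_inner[symmetric] power2_eq_square)
  qed (simp add: linear_0[OF lin])
  have "B x \<bullet> y = (\<mu> *\<^sub>R x) \<bullet> y" for x y
    using q[of "x + y"] q[of x] q[of y] sym[of x y]
    by (simp add: linear_add[OF lin] inner_add_left inner_add_right inner_commute algebra_simps)
  then have "B = (\<lambda>x. \<mu> *\<^sub>R x)" using vector_eq_rdot by blast
  then show ?thesis by (rule that)
qed

text \<open>In the proof that charge forces \<open>B\<close> to be scalar, \<open>K\<close> is the lower left block of \<open>\<rho>(q)\<close>, and the
relation \<open>[e^\<flat>, f] = b(e,f) p\<close> says that \<open>e K e\<close> depends on \<open>e\<close> only through its length. Multiplying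
this by \<open>e\<close> from either side shows that Clifford multiplication exchanges \<open>K\<close> and \<open>T\<close>.\<close>

lemma clifford_twist_swap:
  fixes K T :: "'s::euclidean_space \<Rightarrow>\<^sub>L 's"
  assumes c: "clifford_module einner c"
    and twist: "\<And>e x. c e (K (c e x)) = (e \<bullet> e) *\<^sub>R T x"
  shows "K (c e x) = c e (T x)" and "T (c e x) = c e (K x)"
proof -
  have lin: "linear c" using c by (simp add: clifford_module_def)
  note sq = clifford_square_apply[OF c, of e]
  have "(e \<bullet> e) *\<^sub>R K (c e x) = (e \<bullet> e) *\<^sub>R c e (T x)"
    using arg_cong[OF twist[of e x], of "c e"] by (simp add: sq blinfun.scaleR_right)
  then show "K (c e x) = c e (T x)" by (cases "e = 0") (auto simp: linear_0[OF lin])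
  have "(e \<bullet> e) *\<^sub>R c e (K x) = (e \<bullet> e) *\<^sub>R T (c e x)"
    using twist[of e "c e x"] by (simp add: sq blinfun.scaleR_right)
  then show "T (c e x) = c e (K x)" by (cases "e = 0") (auto simp: linear_0[OF lin])
qed

text \<open>The common kernel of \<open>K\<close> and \<open>T\<close> is a submodule because Clifford multiplication exchanges the two
operators, so by irreducibility it vanishes. As moreover \<open>T K = K T = 0\<close>, the sum \<open>K + T\<close> is
invertible. Writing \<open>E\<close> for the inverse, \<open>E K\<close> and \<open>E T\<close> are complementary projections, which play
the role of the projections onto semi-spinors.\<close>

lemma twist_sum_inverse:
  fixes c :: "'e::euclidean_space \<Rightarrow> ('s::euclidean_space \<Rightarrow>\<^sub>L 's)" and K T :: "'s \<Rightarrow>\<^sub>L 's"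
  assumes irr: "irreducible_module c"
    and swap: "\<And>e x. K (c e x) = c e (T x)" "\<And>e x. T (c e x) = c e (K x)"
    and prod: "\<And>x. T (K x) = 0" "\<And>x. K (T x) = 0" and "K \<noteq> 0"
  obtains E where "linear E" "\<And>x. E (K x + T x) = x" "\<And>x. K (E x) + T (E x) = x"
    and "\<And>x. E (K x) = K (E x)" "\<And>x. E (T x) = T (E x)" and "\<exists>x. K (K x) \<noteq> 0"
proof -
  let ?W = "{x. K x = 0 \<and> T x = 0}"
  have "subspace ?W"
    by (auto simp: subspace_def blinfun.add_right blinfun.scaleR_right)
  moreover have "\<forall>e. \<forall>x\<in>?W. c e x \<in> ?W" by (auto simp: swap)
  ultimately have "?W = {0} \<or> ?W = UNIV" using irr unfolding irreducible_module_def by blast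
  moreover have "?W \<noteq> UNIV" using \<open>K \<noteq> 0\<close> by (metis (mono_tags, lifting) UNIV_I blinfun_eqI mem_Collect_eq zero_blinfun.rep_eq)
  ultimately have W: "x = 0" if "K x = 0" "T x = 0" for x using that by blast
  have KK: "\<exists>x. K (K x) \<noteq> 0"
  proof (rule ccontr)
    \<comment> \<open>Otherwise the image of \<open>K\<close> lies in the common kernel.\<close>
    assume "\<not> ?thesis"
    then have "K x = 0" for x using W[of "K x"] prod by auto
    then show False using \<open>K \<noteq> 0\<close> by (auto intro: blinfun_eqI)
  qed
  let ?D = "blinfun_apply (K + T)"
  have lin: "linear ?D" by (rule bounded_linear.linear[OF blinfun.bounded_linear_right])
  moreover have "inj ?D"
  proof (rule iffD2[OF linear_injective_0[OF lin]], intro allI impI)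
    fix x assume "?D x = 0"
    then have D: "K x + T x = 0" by (simp add: blinfun.add_left)
    have "K (K x + T x) = 0" "T (K x + T x) = 0" unfolding D by simp_all
    then have "K (K x) = 0" "T (T x) = 0" by (simp_all add: blinfun.add_right prod)
    then have "K x = 0" "T x = 0" using W[of "K x"] W[of "T x"] prod by auto
    then show "x = 0" by (rule W)
  qed
  ultimately obtain E where E: "linear E" "\<And>x. E (?D x) = x" "\<And>x. ?D (E x) = x"
    using linear_injective_isomorphism by metis
  have com: "E (A x) = A (E x)" if "\<And>y. A (?D y) = ?D (A y)" for A :: "'s \<Rightarrow> 's" and x
    using arg_cong[OF that[of "E x"], of E] by (simp only: E)
  show thesis
  proof (rule that[OF E(1)])
    fix x
    show "E (K x + T x) = x" "K (E x) + T (E x) = x"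
      using E(2,3)[of x] by (simp_all add: blinfun.add_left)
    show "E (K x) = K (E x)" "E (T x) = T (E x)"
      by (rule com; simp add: blinfun.add_left blinfun.add_right prod)+
  qed (rule KK)
qed

text \<open>The algebraic core of the necessity of \<open>B = \<mu> Id\<close>. The operators are the blocks of \<open>\<rho>(q)\<close>, that is
\<open>L\<close>, \<open>N\<close> in the upper row and \<open>K\<close>, \<open>M\<close> in the lower one; \<open>com1\<close>, \<open>com2\<close> are the diagonal blocks of
\<open>[\<rho>(e), \<rho>(f)] = 0\<close>, and \<open>q1\<close>, \<open>q2\<close>, \<open>q3\<close> the upper left, lower right and upper right blocks of
\<open>[\<rho>(q), \<rho>(e)] = \<rho>(e^\<flat>)\<close>.

For orthonormal \<open>u\<close>, \<open>v\<close> the first two give \<open>u v T K = v u T K\<close>, and likewise for \<open>K T\<close>, so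
\<open>T K = K T = 0\<close>. With \<open>X = K L + M K\<close>, the equations \<open>q1\<close> and \<open>q2\<close> become \<open>2 L e K = e X\<close> and
\<open>2 K e M = X e\<close>, while the projection \<open>E K\<close> leaves \<open>K L\<close> and \<open>X\<close> fixed when multiplied from the right
and \<open>M K\<close> and \<open>X\<close> when multiplied from the left. Now \<open>q3\<close> expresses \<open>B e\<close> by the blocks. In
\<open>K (B e) e K\<close> and in \<open>K e (B e) K\<close> every term
that does not vanish has two factors \<open>e\<close>, which these rules bring together,
where they cancel for a unit vector \<open>e\<close>. Hence the sum \<open>2 (B e \<bullet> e) K\<^sup>2\<close> of the two operators is the
same for all unit vectors, and so is \<open>B e \<bullet> e\<close>, because \<open>K\<^sup>2 \<noteq> 0\<close>.\<close>

lemma charge_forces_scalar: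
  fixes c :: "'e::euclidean_space \<Rightarrow> ('s::euclidean_space \<Rightarrow>\<^sub>L 's)" and K L M N T :: "'s \<Rightarrow>\<^sub>L 's"
  assumes c: "clifford_module einner c" and irr: "irreducible_module c"
    and dim: "2 \<le> DIM('e)"
    and B: "linear B" "\<And>x y. B x \<bullet> y = x \<bullet> B y"
    and "K \<noteq> 0"
    and twist: "\<And>e x. c e (K (c e x)) = (e \<bullet> e) *\<^sub>R T x"
    and com1: "\<And>e f x. c e (K (c f (K x))) = c f (K (c e (K x)))"
    and com2: "\<And>e f x. K (c e (K (c f x))) = K (c f (K (c e x)))"
    and q1: "\<And>e x. 2 *\<^sub>R L (c e (K x)) = c e (K (L x) + M (K x))"
    and q2: "\<And>e x. 2 *\<^sub>R K (c e (M x)) = K (L (c e x)) + M (K (c e x))"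
    and q3: "\<And>e x. c (B e) x = 2 *\<^sub>R L (c e (M x)) - L (L (c e x)) - c e (M (M x))
                 - N (K (c e x)) - c e (K (N x))"
  obtains \<mu> where "B = (\<lambda>x. \<mu> *\<^sub>R x)"
proof -
  note pol = clifford_polarized_apply[OF c]
  have sq: "c e (c e x) = x" if "norm e = 1" for e x
    using that clifford_square_apply[OF c, of e x] by (simp add: norm_eq_1)
  note swap = clifford_twist_swap[OF c twist]
  note lin = blinfun.add_right blinfun.scaleR_right blinfun.diff_right blinfun.minus_right
  obtain u v :: 'e where uv: "norm u = 1" "norm v = 1" "u \<bullet> v = 0"
  proof -
    obtain u where "u \<in> (Basis :: 'e set)" using nonempty_Basis by blast
    moreover have "Basis \<noteq> {u}"
    proof
      assume "Basis = {u}"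
      then have "DIM('e) = card {u}" by (rule arg_cong)
      then show False using dim by simp
    qed
    ultimately obtain v where "v \<in> Basis" "v \<noteq> u" by blast
    then show ?thesis using \<open>u \<in> Basis\<close> that[of u v] by (auto simp: inner_Basis)
  qed
  have zero: "y = 0" if "c u (c v y) = c v (c u y)" for y
  proof -
    have "c u (c v y) + c v (c u y) = 0" using pol[of u v y] uv by simp
    then have "2 *\<^sub>R c u (c v y) = 0" unfolding that[symmetric] scaleR_2 .
    then have "c u (c v y) = 0" by simp
    then have "c v (c u (c u (c v y))) = 0" by simp
    then show ?thesis by (simp add: sq uv)
  qed
  have TK: "T (K x) = 0" for x using com1[of u v x] by (intro zero) (simp add: swap)
  have KT: "K (T x) = 0" for x using com2[of u v x] by (intro zero) (simp add: swap)
  obtain E where linE: "linear E" and E: "\<And>x. E (K x + T x) = x" "\<And>x. K (E x) + T (E x) = x"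
    and comE: "\<And>x. E (K x) = K (E x)" "\<And>x. E (T x) = T (E x)" and KK: "\<exists>x. K (K x) \<noteq> 0"
    by (rule twist_sum_inverse[OF irr swap TK KT \<open>K \<noteq> 0\<close>]) (rule that)
  define X where "X = (K o\<^sub>L L) + (M o\<^sub>L K)"
  have X: "X x = K (L x) + M (K x)" for x by (simp add: X_def blinfun.add_left)
  have LeK: "L (c e (K x)) = (1/2) *\<^sub>R c e (X x)" and KeM: "K (c e (M x)) = (1/2) *\<^sub>R X (c e x)" for e x
    by (simp_all add: X flip: q1 q2)
  \<comment> \<open>Both sides are \<open>e X e / 2\<close> for any unit vector \<open>e\<close>, by the two equations above.\<close>
  have LT: "L (T x) = T (M x)" for x
  proof -
    have "L (T x) = L (c u (K (c u x)))" by (simp add: swap sq uv)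
    also have "\<dots> = c u (K (c u (M x)))" by (simp add: LeK KeM lin)
    also have "\<dots> = T (M x)" by (simp add: swap sq uv)
    finally show ?thesis .
  qed
  have KLT: "K (L (T x)) = 0" and TMK: "T (M (K x)) = 0" for x
    by (simp add: LT KT, simp add: TK flip: LT)
  have XT: "X (T x) = 0" and TX: "T (X x) = 0" for x
    by (simp_all add: X lin KLT TMK KT TK)
  have decomp: "x = E (K x) + E (T x)" for x using E(1)[of x] by (simp add: linear_add[OF linE])
  \<comment> \<open>How the projection \<open>E K\<close> is absorbed: in each case its complement \<open>E T\<close> is annihilated.\<close>
  have KL: "K (L x) = K (L (E (K x)))" for x
    using arg_cong[OF decomp[of x], of "\<lambda>x. K (L x)"] by (simp add: lin comE(2) KLT)
  have Xr: "X x = X (E (K x))" for x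
    using arg_cong[OF decomp[of x], of X] by (simp add: lin comE(2) XT)
  have Xl: "X x = K (E (X x))" for x
    using E(2)[of "X x"] by (simp add: TX linear_0[OF linE] flip: comE)
  have MK: "M (K x) = K (E (M (K x)))" for x
    using E(2)[of "M (K x)"] by (simp add: TMK linear_0[OF linE] flip: comE)
  have linE': "E (r *\<^sub>R x) = r *\<^sub>R E x" for r x using linE by (rule linear_scale)

  \<comment> \<open>What remains of \<open>K (B e) e K + K e (B e) K\<close> for a unit vector \<open>e\<close> after all \<open>e\<close> have cancelled.\<close>
  define C where "C x = K (L (E (X (K x)))) - K (L (L (K x))) - (1/4) *\<^sub>R X (E (X (K x))) - K (N (K (K x)))
     + (K (X (E (M (K x)))) - (1/4) *\<^sub>R K (X (E (X x))) - K (M (M (K x))) - K (K (N (K x))))" for x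
  have main: "(2 * (B e \<bullet> e)) *\<^sub>R K (K x) = C x" if e: "norm e = 1" for e x
  proof -
    have 1: "K (L (c e (M (c e (K x))))) = (1/2) *\<^sub>R K (L (E (X (K x))))"
      by (subst KL) (simp add: KeM sq e lin linE')
    have 2: "K (c e (M (M (c e (K x))))) = (1/4) *\<^sub>R X (E (X (K x)))"
    proof -
      have "K (c e (M (M (c e (K x))))) = (1/2) *\<^sub>R X (c e (M (c e (K x))))" by (simp add: KeM)
      also have "\<dots> = (1/4) *\<^sub>R X (E (X (K x)))"
        by (subst Xr) (simp add: KeM sq e lin linE')
      finally show ?thesis .
    qed
    have 3: "K (c e (K y)) = 0" for y by (simp add: swap TK)
    have A: "K (c (B e) (c e (K x))) = K (L (E (X (K x)))) - K (L (L (K x)))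
        - (1/4) *\<^sub>R X (E (X (K x))) - K (N (K (K x)))"
      unfolding q3[of e] by (simp add: lin 1 2 3 sq e)
    have 4: "L (c e (M (K x))) = (1/2) *\<^sub>R c e (X (E (M (K x))))"
      by (subst MK) (simp add: LeK)
    have 5: "L (L (c e (K x))) = (1/4) *\<^sub>R c e (X (E (X x)))"
    proof -
      have "L (L (c e (K x))) = (1/2) *\<^sub>R L (c e (X x))" by (simp add: LeK lin)
      also have "\<dots> = (1/4) *\<^sub>R c e (X (E (X x)))"
        by (subst Xl) (simp add: LeK)
      finally show ?thesis .
    qed
    have A': "K (c e (c (B e) (K x))) = K (X (E (M (K x)))) - (1/4) *\<^sub>R K (X (E (X x)))
        - K (M (M (K x))) - K (K (N (K x)))"
      unfolding q3[of e] by (simp add: lin 3 4 5 sq e)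
    have "(2 * (B e \<bullet> e)) *\<^sub>R K (K x) = K ((2 * (B e \<bullet> e)) *\<^sub>R K x)" by (simp add: lin)
    also have "\<dots> = K (c (B e) (c e (K x))) + K (c e (c (B e) (K x)))"
      unfolding pol[symmetric] by (simp add: lin)
    also have "\<dots> = C x" unfolding A A' C_def ..
    finally show ?thesis .
  qed
  obtain z where z: "K (K z) \<noteq> 0" using KK by blast
  have "B e \<bullet> e = B f \<bullet> f" if "norm e = 1" "norm f = 1" for e f
  proof -
    have "(2 * (B e \<bullet> e)) *\<^sub>R K (K z) = (2 * (B f \<bullet> f)) *\<^sub>R K (K z)"
      by (simp only: main[OF that(1)] main[OF that(2)])
    then show ?thesis using z by simp
  qed
  then show thesis using scalar_of_constant_quadratic_form[OF B] that by blast
qed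

text \<open>Since \<open>B\<close> is onto, \<open>[e^\<flat>, q] = B e\<close> determines \<open>\<rho>(u)\<close> from the blocks of \<open>\<rho>(q)\<close> for every \<open>u\<close>. Then
\<open>[e^\<flat>, f] = b(e,f) p\<close> shows that \<open>\<rho>(p)\<close> has a single nonzero block, proportional to \<open>u K u\<close> for any
unit vector \<open>u\<close>; so nonzero charge means \<open>K \<noteq> 0\<close>.\<close>

lemma charged_spin_representation_scalar:
  fixes b :: "'e::euclidean_space \<Rightarrow> 'e \<Rightarrow> real" and c :: "'e \<Rightarrow> ('s::euclidean_space \<Rightarrow>\<^sub>L 's)"
  assumes b: "bilinear b" "symmetric_form b" "nondegenerate_form b" and dim: "2 \<le> DIM('e)"
    and c: "clifford_module einner c" "irreducible_module c" and \<gamma>: "spin_module c \<gamma>"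
    and spin: "spin_representation b \<gamma> \<rho>" and charge: "nonzero_charge \<rho>"
  obtains \<mu> where "cw_endo b = (\<lambda>x. \<mu> *\<^sub>R x)"
proof -
  define B where "B = cw_endo b"
  have linB: "linear B" unfolding B_def by (rule linear_cw_endo[OF b(1)])
  have bB: "b e f = B e \<bullet> f" for e f using cw_endo[OF b(1), of e f] by (simp add: B_def einner_def)
  have symB: "B x \<bullet> y = x \<bullet> B y" for x y
    using b(2) by (metis bB inner_commute symmetric_form_def)
  have "inj B"
    using b(3) by (subst linear_injective_0[OF linB]) (auto simp: nondegenerate_form_def bB)
  then have "surj B" using linear_injective_imp_surjective[OF linB] by blast
  then obtain B' where B': "\<And>u. B (B' u) = u" by (metis surj_def)
  have rep: "lie_representation (cw_bracket b) \<rho>"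
    and h: "\<rho> (in_h (flat e)) = block 0 (sqrt 2 *\<^sub>R c (B e)) 0 0" for e
    using spin spin_representation_block[OF \<gamma>] by (auto simp: B_def)
  note rel = cw_representation_relations[OF b(1) rep]
  obtain L N K M where Q: "\<rho> (in_m vec_q) = block L N K M" by (rule block_decomposition)
  obtain P11 P12 P21 P22 where P: "\<rho> (in_m vec_p) = block P11 P12 P21 P22" by (rule block_decomposition)
  note calc = block_compose block_linear block_eq_iff compose_bilinear compose_assoc
  have E: "\<rho> (in_m (vec_E u)) = sqrt 2 *\<^sub>R block (c u o\<^sub>L K) ((c u o\<^sub>L M) - (L o\<^sub>L c u)) 0 (- (K o\<^sub>L c u))" for u
    using rel(3)[of "B' u"] by (simp add: Q h B' calc algebra_simps flip: B_def)
  have charge_block: "(u \<bullet> f) *\<^sub>R \<rho> (in_m vec_p) = block 0 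
      (- (2 *\<^sub>R (c u o\<^sub>L (K o\<^sub>L c f))) - 2 *\<^sub>R (c f o\<^sub>L (K o\<^sub>L c u))) 0 0" for u f
    using rel(2)[of "B' u" f, symmetric] by (simp add: E h B' bB calc algebra_simps)
  \<comment> \<open>For equal arguments the two terms of \<open>charge_block\<close> add up to \<open>-4 u K u\<close>, so \<open>T = -P12/4\<close>.\<close>
  have twist: "c e (K (c e x)) = (e \<bullet> e) *\<^sub>R ((- (1/4)) *\<^sub>R P12) x" for e x
  proof -
    have "(e \<bullet> e) *\<^sub>R P12 = - 4 *\<^sub>R (c e o\<^sub>L (K o\<^sub>L c e))"
      using charge_block[of e e] by (simp add: P block_linear block_eq_iff flip: scaleR_minus_left scaleR_diff_left)
    from arg_cong[OF this, of "\<lambda>A. (-(1/4)) *\<^sub>R blinfun_apply A x"] show ?thesis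
      by (simp add: blinfun.scaleR_left blinfun.minus_left)
  qed
  have "K \<noteq> 0"
  proof
    assume K0: "K = 0"
    obtain u :: 'e where "norm u = 1" by (metis nonempty_Basis norm_Basis ex_in_conv)
    then have "\<rho> (in_m vec_p) = 0"
      using charge_block[of u u] by (simp add: K0 calc norm_eq_1)
    then show False using charge by (simp add: nonzero_charge_def)
  qed
  have com: "c e o\<^sub>L (K o\<^sub>L (c f o\<^sub>L K)) = c f o\<^sub>L (K o\<^sub>L (c e o\<^sub>L K))"
    "K o\<^sub>L (c e o\<^sub>L (K o\<^sub>L c f)) = K o\<^sub>L (c f o\<^sub>L (K o\<^sub>L c e))" for e f
    using rel(4)[of e f] by (simp_all add: E calc)
  have "(L o\<^sub>L (c e o\<^sub>L K)) - ((c e o\<^sub>L (K o\<^sub>L L)) + ((c e o\<^sub>L (M o\<^sub>L K)) - (L o\<^sub>L (c e o\<^sub>L K)))) = 0 \<and>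
    (K o\<^sub>L (c e o\<^sub>L M)) - (K o\<^sub>L (L o\<^sub>L c e)) - (M o\<^sub>L (K o\<^sub>L c e)) + (K o\<^sub>L (c e o\<^sub>L M)) = 0 \<and>
    (L o\<^sub>L (c e o\<^sub>L M)) - (L o\<^sub>L (L o\<^sub>L c e)) - (N o\<^sub>L (K o\<^sub>L c e)) - ((c e o\<^sub>L (K o\<^sub>L N))
      + ((c e o\<^sub>L (M o\<^sub>L M)) - (L o\<^sub>L (c e o\<^sub>L M)))) = c (B e)" for e
  proof -
    have "block 0 (sqrt 2 *\<^sub>R c (B e)) 0 0 = sqrt 2 *\<^sub>R block 0 (c (B e)) 0 0"
      by (simp add: block_linear)
    then have "sqrt 2 *\<^sub>R ((block L N K M o\<^sub>L block (c e o\<^sub>L K) ((c e o\<^sub>L M) - (L o\<^sub>L c e)) 0 (- (K o\<^sub>L c e)))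
        - (block (c e o\<^sub>L K) ((c e o\<^sub>L M) - (L o\<^sub>L c e)) 0 (- (K o\<^sub>L c e)) o\<^sub>L block L N K M))
        = sqrt 2 *\<^sub>R block 0 (c (B e)) 0 0"
      using rel(1)[of e] by (simp only: E Q h compose_bilinear(7,8) scaleR_diff_right)
    then have "(block L N K M o\<^sub>L block (c e o\<^sub>L K) ((c e o\<^sub>L M) - (L o\<^sub>L c e)) 0 (- (K o\<^sub>L c e)))
        - (block (c e o\<^sub>L K) ((c e o\<^sub>L M) - (L o\<^sub>L c e)) 0 (- (K o\<^sub>L c e)) o\<^sub>L block L N K M)
        = block 0 (c (B e)) 0 0" by simp
    then show ?thesis by (simp add: calc)
  qed
  note q = this[THEN conjunct1] this[THEN conjunct2, THEN conjunct1] this[THEN conjunct2, THEN conjunct2]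
  have app: "A x = A' x" if "A = A'" for A A' :: "'s \<Rightarrow>\<^sub>L 's" and x using that by simp
  note ev = blinfun.add_left blinfun.diff_left blinfun.add_right blinfun.diff_right scaleR_2
  obtain \<mu> where "B = (\<lambda>x. \<mu> *\<^sub>R x)"
  proof (rule charge_forces_scalar[OF c dim linB symB \<open>K \<noteq> 0\<close> twist, of L M N])
    fix e f x
    show "c e (K (c f (K x))) = c f (K (c e (K x)))" using app[OF com(1)[of e f], of x] by simp
    show "K (c e (K (c f x))) = K (c f (K (c e x)))" using app[OF com(2)[of e f], of x] by simp
    show "2 *\<^sub>R L (c e (K x)) = c e (K (L x) + M (K x))"
      using app[OF q(1)[of e], of x] by (simp add: ev algebra_simps)
    show "2 *\<^sub>R K (c e (M x)) = K (L (c e x)) + M (K (c e x))"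
      using app[OF q(2)[of e], of x] by (simp add: ev algebra_simps)
    show "c (B e) x = 2 *\<^sub>R L (c e (M x)) - L (L (c e x)) - c e (M (M x)) - N (K (c e x)) - c e (K (N x))"
      using app[OF q(3)[of e], of x, symmetric] by (simp add: ev algebra_simps)
  qed
  then show thesis using that by (simp add: B_def)
qed

text \<open>This turns the normalization of the eigenvalues into \<open>\<mu>\<^sup>2 = 1\<close>.\<close>

lemma scalar_eigenvalue_sequence:
  assumes "eigenvalue_sequence (\<lambda>x::'e::euclidean_space. \<mu> *\<^sub>R x) \<beta>" and "i \<in> {1..DIM('e)}"
  shows "\<beta> i = \<mu>"
proof -
  let ?I = "{j \<in> {1..DIM('e)}. \<beta> j = \<mu>}"
  have "card ?I = dim (UNIV :: 'e set)"
    using assms(1) by (simp add: eigenvalue_sequence_def)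
  then have "card ?I = card {1..DIM('e)}" by (simp add: dim_UNIV)
  then have "?I = {1..DIM('e)}" by (intro card_subset_eq) auto
  then show ?thesis using assms(2) by blast
qed

section \<open>Charged spin representations in dimension eight\<close>

theorem theorem4p5:
  fixes b :: "'e::euclidean_space \<Rightarrow> 'e \<Rightarrow> real"
    and \<beta> :: "nat \<Rightarrow> real"
    and c :: "'e \<Rightarrow> ('s::euclidean_space \<Rightarrow>\<^sub>L 's)"
    and us :: "'e list"
    and \<gamma> :: "'e minkowski \<Rightarrow> (('s \<times> 's) \<Rightarrow>\<^sub>L ('s \<times> 's))"
  assumes dimE: "DIM('e) = 8"
    and form: "bilinear b" "symmetric_form b" "nondegenerate_form b"
    and eigenvalues: "eigenvalue_sequence (cw_endo b) \<beta>"
    and normalization: "(\<Sum>i=1..8. (\<beta> i)\<^sup>2) = 8"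
    and S08: "clifford_module einner c" "irreducible_module c"
    and orientation: "orthonormal_frame us"
    and S19: "spin_module c \<gamma>"
  shows "((\<exists>\<rho>. spin_representation b \<gamma> \<rho> \<and> nonzero_charge \<rho>)
           \<longleftrightarrow> cw_endo b = (\<lambda>x. x) \<or> cw_endo b = (\<lambda>x. - x)) \<and>
         (\<forall>\<epsilon>\<in>{1, -1}. cw_endo b = (\<lambda>x. \<epsilon> *\<^sub>R x) \<longrightarrow>
           (\<exists>\<rho>. spin_representation b \<gamma> \<rho> \<and> nonzero_charge \<rho> \<and>
             (\<forall>e. \<rho> (in_h (flat e)) = sqrt 2 *\<^sub>R block 0 (c (cw_endo b e)) 0 0) \<and>
             (\<forall>e. \<rho> (in_m (vec_E e)) =
                sqrt 2 *\<^sub>R block (- (c e o\<^sub>L semispinor_proj (volume_action c us) (-1))) 0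
                                0 (c e o\<^sub>L semispinor_proj (volume_action c us) 1)) \<and>
             \<rho> (in_m vec_p) =
                4 *\<^sub>R block 0 (semispinor_proj (volume_action c us) 1) 0 0 \<and>
             \<rho> (in_m vec_q) =
                block 0 (\<epsilon> *\<^sub>R id_blinfun)
                      (- semispinor_proj (volume_action c us) (-1)) 0))"
    (is "(?charged \<longleftrightarrow> ?pm) \<and> (\<forall>\<epsilon>\<in>{1, -1}. ?scalar \<epsilon> \<longrightarrow> (\<exists>\<rho>. ?model \<epsilon> \<rho>))")
proof (intro conjI iffI)
  show model: "\<forall>\<epsilon>\<in>{1, -1}. ?scalar \<epsilon> \<longrightarrow> (\<exists>\<rho>. ?model \<epsilon> \<rho>)"
  proof (intro ballI impI)
    fix \<epsilon> :: real assume \<epsilon>: "\<epsilon> \<in> {1, -1}" and B: "cw_endo b = (\<lambda>x. \<epsilon> *\<^sub>R x)"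
    let ?\<omega> = "volume_action c us"
    let ?p = "semispinor_proj ?\<omega> 1" and ?m = "semispinor_proj ?\<omega> (-1)"
    have lin: "linear c" using S08(1) by (simp add: clifford_module_def)
    have invol: "?\<omega> o\<^sub>L ?\<omega> = id_blinfun"
      using volume_action_square[OF S08(1) orthonormal_frameD(1-3)[OF orientation]]
      by (simp add: orthonormal_frameD(4)[OF orientation] dimE choose_two)
    have anti: "c e o\<^sub>L ?\<omega> = - (?\<omega> o\<^sub>L c e)" for e
      by (rule volume_action_anticommute[OF S08(1) orientation]) (simp add: dimE)
    note proj = semispinor_proj_algebra[OF invol]
    have swap: "?p o\<^sub>L c e = c e o\<^sub>L ?m" "?m o\<^sub>L c e = c e o\<^sub>L ?p" for e
      using semispinor_proj_swap[OF anti, of 1 e] semispinor_proj_swap[OF anti, of "-1" e] by simp_all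
    let ?\<rho> = "\<lambda>(\<phi>, e, s, t). block 0 (sqrt 2 *\<^sub>R c (\<epsilon> *\<^sub>R sharp \<phi>)) 0 0
      + block (- (sqrt 2 *\<^sub>R (c e o\<^sub>L ?m))) 0 0 (sqrt 2 *\<^sub>R (c e o\<^sub>L ?p))
      + s *\<^sub>R block 0 (4 *\<^sub>R ?p) 0 0 + t *\<^sub>R block 0 (\<epsilon> *\<^sub>R id_blinfun) (- ?m) 0"
    have rep: "lie_representation (cw_bracket b) ?\<rho>"
      by (rule half_spin_representation[OF form(1) B _ S08(1) proj swap]) (use \<epsilon> in simp)
    \<comment> \<open>If \<open>\<pi>^+\<close> vanished, Clifford multiplication, which exchanges \<open>\<pi>^+\<close> and \<open>\<pi>^-\<close>, would be zero.\<close>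
    have p: "?p \<noteq> 0"
    proof
      assume "?p = 0"
      then have m: "?m = id_blinfun" using proj(5) by simp
      obtain u :: 'e where u: "norm u = 1" by (metis nonempty_Basis norm_Basis ex_in_conv)
      have "c u = 0" using swap(1)[of u] m \<open>?p = 0\<close> by (simp add: compose_id compose_bilinear)
      then have "(id_blinfun :: 's \<Rightarrow>\<^sub>L 's) = 0"
        using clifford_square[OF S08(1), of u] u by (auto simp: norm_eq_1)
      then have "x = (0::'s)" for x by (metis blinfun_apply_id_blinfun zero_blinfun.rep_eq)
      then show False by (metis nonempty_Basis nonzero_Basis ex_in_conv)
    qed
    have gens: "?\<rho> (in_h (flat e)) = sqrt 2 *\<^sub>R block 0 (c (cw_endo b e)) 0 0"
      "?\<rho> (in_m (vec_E e)) = sqrt 2 *\<^sub>R block (- (c e o\<^sub>L ?m)) 0 0 (c e o\<^sub>L ?p)"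
      "?\<rho> (in_m vec_p) = 4 *\<^sub>R block 0 ?p 0 0"
      "?\<rho> (in_m vec_q) = block 0 (\<epsilon> *\<^sub>R id_blinfun) (- ?m) 0" for e
      by (simp_all add: in_h_def in_m_def vec_E_def vec_p_def vec_q_def zero_prod_def block_linear B
          compose_bilinear linear_0[OF lin] linear_0[OF linear_sharp])
    have "block 0 ?p 0 0 \<noteq> block 0 0 0 0" using p by (simp add: block_eq_iff)
    then have charge: "nonzero_charge ?\<rho>"
      unfolding nonzero_charge_def gens(3) by (simp add: block_linear(4))
    have spin: "spin_representation b \<gamma> ?\<rho>"
      unfolding spin_representation_block[OF S19] using rep gens(1) by (simp add: block_linear)
    show "\<exists>\<rho>. ?model \<epsilon> \<rho>"
      by (rule exI[of _ ?\<rho>]) (intro conjI allI spin charge gens)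
  qed
  show "?charged" if ?pm
  proof -
    have "?scalar 1 \<or> ?scalar (-1)" using that by simp
    then obtain \<epsilon> :: real where "\<epsilon> \<in> {1, -1}" "?scalar \<epsilon>" by blast
    then have "\<exists>\<rho>. ?model \<epsilon> \<rho>" by (intro bspec[OF model, THEN mp])
    then show ?thesis by (elim exE conjE) (intro exI conjI)
  qed
  show ?pm if charged: ?charged
  proof -
    obtain \<mu> where \<mu>: "cw_endo b = (\<lambda>x. \<mu> *\<^sub>R x)"
      using charged charged_spin_representation_scalar[OF form _ S08 S19] by (auto simp: dimE)
    have "\<beta> i = \<mu>" if "i \<in> {1..8}" for i
      using scalar_eigenvalue_sequence[OF eigenvalues[unfolded \<mu>], of i] that by (simp add: dimE)
    then have "\<mu>\<^sup>2 = 1" using normalization by simp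
    then have "\<mu> = 1 \<or> \<mu> = -1" by (simp add: power2_eq_1_iff)
    then show ?thesis using \<mu> by auto
  qed
qed

end
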